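(* Let $n\ge5$, $V=\{0,\dots,n-1\}$, and let $p$ be a Markov kernel (possibly non-reversible) with $p(i,j)>0$ iff $j\in\{i\pm1\bmod n\}$. Equip the cycle $C_n=(V,p)$ with the general path distance $d$ for which the Ollivier curvature is constant on all edges (which exists and is unique up to positive scaling). Then the following are equivalent: (i) $C_n$ is Ollivier-Betti sharp; (ii) $C_n$ has zero Ollivier curvature on every edge; (iii) $M_2(C_n)$ contains no 2-cells, i.e. $X_2=\emptyset$.
   Context: Graph: $i\sim j$ iff $p(i,j)>0$. A general path distance is a symmetric $d$ with $d(x,y)=0$ iff $x=y$ and $d(x,y)=\inf\{\sum_kd(x_{k-1},x_k):x=x_0\sim\dots\sim x_m=y\}$. Laplacian $\Delta f(x)=\sum_yp(x,y)(f(y)-f(x))$; $\nabla_{xy}f=(f(x)-f(y))/d(x,y)$; Ollivier curvature $\kappa(x,y)=\inf\{\nabla_{xy}\Delta f:\nabla_{yx}f=1,\sup_{u\ne v}|\nabla_{uv}f|=1\}$. $X_2$: the set of cycles (sequences of distinct vertices $(x_0\sim\dots\sim x_{k-1})$, $k\ge3$, $x_{k-1}\sim x_0$, up to rotation and reversal) admitting a labeling with $k=3$, or with $d(x_0,x_3)<d(x_0,x_1)+d(x_1,x_2)+d(x_2,x_3)$ and $x_3\sim\dots\sim x_{k-1}\sim x_0$ a geodesic. 1-forms are antisymmetric functions on ordered adjacent pairs, $\delta\alpha(c)=\sum_i\alpha(x_i,x_{i+1\bmod k})$, $\delta_0f(x,y)=f(x)-f(y)$, $\beta_1(M_2)=\dim(\ker\delta_1/\operatorname{Im}\delta_0)$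 with $\ker\delta_1=\{\alpha:\delta\alpha=0\text{ on }X_2\}$. Ollivier-Betti sharp: $\kappa\ge0$ on all edges and $\beta_1(M_2)=\deg_{\max}/2$, where $\deg_{\max}$ is the maximal number of neighbors (here $\deg_{\max}=2$). *)

theory Defs
  imports "HOL-Analysis.Analysis"
begin

definition markov_kernel :: "'a set \<Rightarrow> ('a \<Rightarrow> 'a \<Rightarrow> real) \<Rightarrow> bool" where
  "markov_kernel V p \<longleftrightarrow>
     (\<forall>x\<in>V. (\<forall>y\<in>V. p x y \<ge> 0) \<and> (\<Sum>y\<in>V. p x y) = 1)"

definition adj :: "'a set \<Rightarrow> ('a \<Rightarrow> 'a \<Rightarrow> real) \<Rightarrow> 'a \<Rightarrow> 'a \<Rightarrow> bool" where
  "adj V p x y \<longleftrightarrow> x \<in> V \<and> y \<in> V \<and> p x y > 0"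

definition max_degree :: "'a set \<Rightarrow> ('a \<Rightarrow> 'a \<Rightarrow> real) \<Rightarrow> nat" where
  "max_degree V p = Max ((\<lambda>x. card {y. adj V p x y}) ` V)"

definition walk :: "'a set \<Rightarrow> ('a \<Rightarrow> 'a \<Rightarrow> real) \<Rightarrow> 'a list \<Rightarrow> bool" where
  "walk V p xs \<longleftrightarrow> xs \<noteq> [] \<and> set xs \<subseteq> V \<and>
     (\<forall>i. Suc i < length xs \<longrightarrow> adj V p (xs ! i) (xs ! Suc i))"

definition walk_length :: "('a \<Rightarrow> 'a \<Rightarrow> real) \<Rightarrow> 'a list \<Rightarrow> real" where
  "walk_length d xs = (\<Sum>i<length xs - 1. d (xs ! i) (xs ! Suc i))"

definition general_path_distance ::
    "'a set \<Rightarrow> ('a \<Rightarrow> 'a \<Rightarrow> real) \<Rightarrow> ('a \<Rightarrow> 'a \<Rightarrow> real) \<Rightarrow> bool" where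
  "general_path_distance V p d \<longleftrightarrow>
     (\<forall>x\<in>V. \<forall>y\<in>V. d x y \<ge> 0 \<and> d x y = d y x \<and> (d x y = 0 \<longleftrightarrow> x = y) \<and>
        d x y = Inf {walk_length d xs | xs. walk V p xs \<and> hd xs = x \<and> last xs = y})"

definition geodesic ::
    "'a set \<Rightarrow> ('a \<Rightarrow> 'a \<Rightarrow> real) \<Rightarrow> ('a \<Rightarrow> 'a \<Rightarrow> real) \<Rightarrow> 'a list \<Rightarrow> bool" where
  "geodesic V p d xs \<longleftrightarrow> walk V p xs \<and> walk_length d xs = d (hd xs) (last xs)"

definition laplacian :: "'a set \<Rightarrow> ('a \<Rightarrow> 'a \<Rightarrow> real) \<Rightarrow> ('a \<Rightarrow> real) \<Rightarrow> 'a \<Rightarrow> real" where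
  "laplacian V p f x = (\<Sum>y\<in>V. p x y * (f y - f x))"

definition grad :: "('a \<Rightarrow> 'a \<Rightarrow> real) \<Rightarrow> 'a \<Rightarrow> 'a \<Rightarrow> ('a \<Rightarrow> real) \<Rightarrow> real" where
  "grad d x y f = (f x - f y) / d x y"

definition ollivier_curvature ::
    "'a set \<Rightarrow> ('a \<Rightarrow> 'a \<Rightarrow> real) \<Rightarrow> ('a \<Rightarrow> 'a \<Rightarrow> real) \<Rightarrow> 'a \<Rightarrow> 'a \<Rightarrow> real" where
  "ollivier_curvature V p d x y =
     Inf {grad d x y (laplacian V p f) | f.
            grad d y x f = 1 \<and>
            Sup {\<bar>grad d u v f\<bar> | u v. u \<in> V \<and> v \<in> V \<and> u \<noteq> v} = 1}"

definition constant_curvature ::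
    "'a set \<Rightarrow> ('a \<Rightarrow> 'a \<Rightarrow> real) \<Rightarrow> ('a \<Rightarrow> 'a \<Rightarrow> real) \<Rightarrow> bool" where
  "constant_curvature V p d \<longleftrightarrow>
     (\<exists>K. \<forall>x y. adj V p x y \<longrightarrow> ollivier_curvature V p d x y = K)"

definition graph_cycle :: "'a set \<Rightarrow> ('a \<Rightarrow> 'a \<Rightarrow> real) \<Rightarrow> 'a list \<Rightarrow> bool" where
  "graph_cycle V p xs \<longleftrightarrow>
     length xs \<ge> 3 \<and> distinct xs \<and> walk V p xs \<and> adj V p (last xs) (hd xs)"

definition cycle_class :: "'a list \<Rightarrow> 'a list set" where
  "cycle_class xs = {ys. \<exists>m. ys = rotate m xs \<or> ys = rotate m (rev xs)}"

text \<open>For a labeled cycle \<open>xs = [x\<^sub>0, \<dots>, x\<^sub>k\<^sub>-\<^sub>1]\<close> the list \<open>drop 3 xs @ [xs ! 0]\<close> is the path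
  \<open>x\<^sub>3, \<dots>, x\<^sub>k\<^sub>-\<^sub>1, x\<^sub>0\<close>.\<close>

definition cell_labeling ::
    "'a set \<Rightarrow> ('a \<Rightarrow> 'a \<Rightarrow> real) \<Rightarrow> ('a \<Rightarrow> 'a \<Rightarrow> real) \<Rightarrow> 'a list \<Rightarrow> bool" where
  "cell_labeling V p d xs \<longleftrightarrow>
     length xs = 3 \<or>
     length xs \<ge> 4 \<and>
     d (xs ! 0) (xs ! 3) < d (xs ! 0) (xs ! 1) + d (xs ! 1) (xs ! 2) + d (xs ! 2) (xs ! 3) \<and>
     geodesic V p d (drop 3 xs @ [xs ! 0])"

definition two_cells ::
    "'a set \<Rightarrow> ('a \<Rightarrow> 'a \<Rightarrow> real) \<Rightarrow> ('a \<Rightarrow> 'a \<Rightarrow> real) \<Rightarrow> 'a list set set" where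
  "two_cells V p d = {cycle_class xs | xs. graph_cycle V p xs \<and> cell_labeling V p d xs}"

text \<open>Functions on the ordered adjacent pairs are represented by functions on all pairs that
  vanish off the adjacent ones.\<close>

definition one_forms :: "'a set \<Rightarrow> ('a \<Rightarrow> 'a \<Rightarrow> real) \<Rightarrow> ('a \<times> 'a \<Rightarrow> real) set" where
  "one_forms V p = {\<alpha>. \<forall>x y. (adj V p x y \<longrightarrow> \<alpha> (x, y) = - \<alpha> (y, x)) \<and>
                             (\<not> adj V p x y \<longrightarrow> \<alpha> (x, y) = 0)}"

definition coboundary0 ::
    "'a set \<Rightarrow> ('a \<Rightarrow> 'a \<Rightarrow> real) \<Rightarrow> ('a \<Rightarrow> real) \<Rightarrow> ('a \<times> 'a \<Rightarrow> real)" where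
  "coboundary0 V p f = (\<lambda>(x, y). if adj V p x y then f x - f y else 0)"

definition coboundary1 :: "('a \<times> 'a \<Rightarrow> real) \<Rightarrow> 'a list \<Rightarrow> real" where
  "coboundary1 \<alpha> xs = (\<Sum>i<length xs. \<alpha> (xs ! i, xs ! (Suc i mod length xs)))"

text \<open>The value of \<open>coboundary1 \<alpha>\<close> on a 2-cell is determined up to sign by the choice of
  representative, so its vanishing may be tested on all representatives.\<close>

definition closed_forms ::
    "'a set \<Rightarrow> ('a \<Rightarrow> 'a \<Rightarrow> real) \<Rightarrow> ('a \<Rightarrow> 'a \<Rightarrow> real) \<Rightarrow> ('a \<times> 'a \<Rightarrow> real) set" where
  "closed_forms V p d =
     {\<alpha> \<in> one_forms V p. \<forall>c \<in> two_cells V p d. \<forall>xs \<in> c. coboundary1 \<alpha> xs = 0}"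

definition exact_forms :: "'a set \<Rightarrow> ('a \<Rightarrow> 'a \<Rightarrow> real) \<Rightarrow> ('a \<times> 'a \<Rightarrow> real) set" where
  "exact_forms V p = range (coboundary0 V p)"

text \<open>\<open>quotient_basis U W S\<close>: the cosets \<open>s + W\<close> with \<open>s \<in> S\<close> are distinct and form a (finite)
  basis of \<open>U / W\<close>, i.e. every coset is a unique linear combination of them.\<close>

definition quotient_basis :: "('b \<Rightarrow> real) set \<Rightarrow> ('b \<Rightarrow> real) set \<Rightarrow> ('b \<Rightarrow> real) set \<Rightarrow> bool" where
  "quotient_basis U W S \<longleftrightarrow> finite S \<and> S \<subseteq> U \<and>
     (\<forall>\<alpha>\<in>U. \<exists>!c. c \<in> S \<rightarrow>\<^sub>E UNIV \<and> (\<lambda>e. \<alpha> e - (\<Sum>s\<in>S. c s * s e)) \<in> W)"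

definition quotient_dim :: "('b \<Rightarrow> real) set \<Rightarrow> ('b \<Rightarrow> real) set \<Rightarrow> nat" where
  "quotient_dim U W = (THE k. \<exists>S. quotient_basis U W S \<and> card S = k)"

definition betti1 :: "'a set \<Rightarrow> ('a \<Rightarrow> 'a \<Rightarrow> real) \<Rightarrow> ('a \<Rightarrow> 'a \<Rightarrow> real) \<Rightarrow> nat" where
  "betti1 V p d = quotient_dim (closed_forms V p d) (exact_forms V p)"

definition ollivier_betti_sharp ::
    "'a set \<Rightarrow> ('a \<Rightarrow> 'a \<Rightarrow> real) \<Rightarrow> ('a \<Rightarrow> 'a \<Rightarrow> real) \<Rightarrow> bool" where
  "ollivier_betti_sharp V p d \<longleftrightarrow>
     (\<forall>x y. adj V p x y \<longrightarrow> ollivier_curvature V p d x y \<ge> 0) \<and>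
     real (betti1 V p d) = real (max_degree V p) / 2"

end

theory Submission
  imports Defs
begin

text \<open>
  Write \<open>w i\<close> for the length of the edge \<open>{i, i + 1}\<close> and \<open>L\<close> for the total length. A general path
  distance on the cycle is the arc length metric of a circle, and its curvature is
  \<open>\<kappa>(i, i + 1) = 2 - T(w) i / w i\<close>, where \<open>T(w) i\<close> is the optimal transport cost between
  \<open>\<delta>\<^sub>i + p i\<close> and \<open>\<delta>\<^sub>i\<^sub>+\<^sub>1 + p (i + 1)\<close>; it is an explicit minimum of nonnegative linear forms in \<open>w\<close>.
  Constant curvature means that \<open>w\<close> is an eigenvector of the monotone homogeneous operator \<open>T\<close>, so
  existence and uniqueness are a nonlinear Perron-Frobenius statement: \<open>T\<close> preserves the cone of
  edge lengths satisfying the polygon inequality, and although \<open>T\<close> is not strongly monotone, it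
  fails to be so only along single coordinates, where concavity helps.

  Summing over all edges, \<open>\<Sum> T(w) i \<le> 2 L\<close> with equality iff any three consecutive edges have total
  length at most \<open>L / 2\<close>. Hence a constant curvature is nonnegative, and it vanishes iff there is no
  2-cell. As every 2-cell is the whole cycle, the first Betti number is 1 without 2-cells and 0
  otherwise.
\<close>

section \<open>The cycle and its transport costs\<close>

locale cycle_chain =
  fixes n :: nat and p :: "nat \<Rightarrow> nat \<Rightarrow> real"
  assumes n5: "n \<ge> 5"
    and kernel: "markov_kernel {0..<n} p"
    and support: "\<forall>i\<in>{0..<n}. \<forall>j\<in>{0..<n}. p i j > 0 \<longleftrightarrow> j \<in> {(i + 1) mod n, (i + n - 1) mod n}"
begin

abbreviation V :: "nat set" where "V \<equiv> {0..<n}"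

definition nx :: "nat \<Rightarrow> nat" where "nx i = (if Suc i = n then 0 else Suc i)"
definition pv :: "nat \<Rightarrow> nat" where "pv i = (if i = 0 then n - 1 else i - 1)"

lemma nx_less [simp]: "i < n \<Longrightarrow> nx i < n"
  by (auto simp: nx_def)

lemma pv_less [simp]: "i < n \<Longrightarrow> pv i < n"
  by (auto simp: pv_def)

lemma nx_pv [simp]: "i < n \<Longrightarrow> nx (pv i) = i"
  by (auto simp: nx_def pv_def)

lemma pv_nx [simp]: "i < n \<Longrightarrow> pv (nx i) = i"
  by (auto simp: nx_def pv_def)

lemma nx_pv_distinct:
  assumes "i < n"
  shows "nx i \<noteq> i" "pv i \<noteq> i" "pv i \<noteq> nx i" "nx (nx i) \<noteq> i" "nx (nx i) \<noteq> nx i"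
    "nx (nx i) \<noteq> pv i" "nx (nx (nx i)) \<noteq> pv i" "nx (nx (nx i)) \<noteq> i"
  using assms n5 by (auto simp: nx_def pv_def split: if_splits)

lemma bij_betw_nx: "bij_betw nx V V"
  by (rule bij_betwI[where g = pv]) auto

lemma sum_nx: "(\<Sum>i\<in>V. f (nx i)) = (\<Sum>i\<in>V. f i)"
  by (rule sum.reindex_bij_betw[OF bij_betw_nx])

lemma p_pos_iff:
  assumes "i < n" "j < n"
  shows "p i j > 0 \<longleftrightarrow> j = nx i \<or> j = pv i"
proof -
  have "(i + 1) mod n = nx i"
    using assms by (auto simp: nx_def)
  moreover have "(i + n - 1) mod n = pv i"
  proof (cases "i = 0")
    case False
    then have "i + n - 1 = (i - 1) + n" by simp
    then have "(i + n - 1) mod n = (i - 1) mod n" by (simp only: mod_add_self2)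
    then show ?thesis using assms False by (simp add: pv_def)
  qed (use n5 in \<open>simp add: pv_def\<close>)
  ultimately show ?thesis using support assms by auto
qed

lemma adj_iff: "adj V p x y \<longleftrightarrow> x < n \<and> (y = nx x \<or> y = pv x)"
  using p_pos_iff by (auto simp: adj_def)

lemma adj_sym: "adj V p x y \<Longrightarrow> adj V p y x"
  by (auto simp: adj_iff)

lemma sum_p:
  assumes "i < n"
  shows "(\<Sum>y\<in>V. p i y * g y) = p i (nx i) * g (nx i) + p i (pv i) * g (pv i)"
proof -
  have "(\<Sum>y\<in>V. p i y * g y) = (\<Sum>y\<in>{nx i, pv i}. p i y * g y)"
  proof (rule sum.mono_neutral_right)
    show "\<forall>y\<in>V - {nx i, pv i}. p i y * g y = 0"
    proof
      fix y assume y: "y \<in> V - {nx i, pv i}"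
      then have "\<not> p i y > 0" "p i y \<ge> 0"
        using p_pos_iff[of i y] assms kernel by (auto simp: markov_kernel_def)
      then show "p i y * g y = 0" by simp
    qed
  qed (use assms in auto)
  then show ?thesis using nx_pv_distinct[OF assms] by simp
qed

definition bwd :: "nat \<Rightarrow> real" where "bwd i = p i (pv i)"

lemma p_nx: "i < n \<Longrightarrow> p i (nx i) = 1 - bwd i"
  using sum_p[of i "\<lambda>_. 1"] kernel by (simp add: markov_kernel_def bwd_def)

lemma bwd_bounds: "i < n \<Longrightarrow> 0 < bwd i \<and> bwd i < 1"
  using p_nx[of i] p_pos_iff[of i "nx i"] p_pos_iff[of i "pv i"] by (simp add: bwd_def)

lemma laplacian_eq:
  "i < n \<Longrightarrow> laplacian V p f i = (1 - bwd i) * (f (nx i) - f i) + bwd i * (f (pv i) - f i)"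
  using sum_p[of i "\<lambda>y. f y - f i"] p_nx[of i] by (simp add: laplacian_def bwd_def)

text \<open>The arguments \<open>y\<close>, \<open>S\<close>, \<open>T\<close>, \<open>Q\<close> are the distances of the pairs \<open>(i, i + 1)\<close>,
  \<open>(i - 1, i + 1)\<close>, \<open>(i, i + 2)\<close>, \<open>(i - 1, i + 2)\<close>. The value is the optimal cost of transporting
  the measure \<open>\<delta>\<^sub>i + p i\<close> to \<open>\<delta>\<^sub>i\<^sub>+\<^sub>1 + p (i + 1)\<close>: the second plan moves the mass \<open>m\<close>
  from \<open>i - 1\<close> to \<open>i + 2\<close>, the first one none.\<close>

definition cost :: "nat \<Rightarrow> real \<Rightarrow> real \<Rightarrow> real \<Rightarrow> real \<Rightarrow> real" where
  "cost i y S T Q = (let \<beta> = bwd i; \<alpha> = 1 - bwd (nx i); m = min \<alpha> \<beta> in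
     min (\<beta> * S + \<alpha> * T) (m * y + (\<beta> - m) * S + (\<alpha> - m) * T + m * Q))"

definition W1 :: "(nat \<Rightarrow> nat \<Rightarrow> real) \<Rightarrow> nat \<Rightarrow> real" where
  "W1 d i = cost i (d i (nx i)) (d (pv i) (nx i)) (d i (nx (nx i))) (d (pv i) (nx (nx i)))"

text \<open>Distinct points at distance 0 are allowed, since the compactness argument for
  eigenvectors runs over a closed set of edge lengths where some \<open>w i\<close> may
  vanish.\<close>

definition pseudometric :: "(nat \<Rightarrow> nat \<Rightarrow> real) \<Rightarrow> bool" where
  "pseudometric d \<longleftrightarrow> (\<forall>x\<in>V. d x x = 0) \<and> (\<forall>x\<in>V. \<forall>y\<in>V. d x y \<ge> 0 \<and> d x y = d y x) \<and>
     (\<forall>x\<in>V. \<forall>y\<in>V. \<forall>z\<in>V. d x z \<le> d x y + d y z)"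

definition lipschitz1 :: "(nat \<Rightarrow> nat \<Rightarrow> real) \<Rightarrow> (nat \<Rightarrow> real) \<Rightarrow> bool" where
  "lipschitz1 d f \<longleftrightarrow> (\<forall>u\<in>V. \<forall>v\<in>V. f u - f v \<le> d u v)"

text \<open>The integral of \<open>f\<close> against the sum of a unit mass at \<open>i\<close> and
  the measure \<open>p i\<close>.\<close>

definition jump :: "(nat \<Rightarrow> real) \<Rightarrow> nat \<Rightarrow> real" where
  "jump f i = 2 * f i + laplacian V p f i"

text \<open>Cancelling common mass at \<open>i\<close> and \<open>nx i\<close> leaves two moves
  across two edges each.\<close>

lemma jump_diff:
  assumes "i < n"
  shows "jump f (nx i) - jump f i =
    bwd i * (f (nx i) - f (pv i)) + (1 - bwd (nx i)) * (f (nx (nx i)) - f i)"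
  using assms by (simp add: jump_def laplacian_eq algebra_simps)

lemma weights:
  assumes "i < n"
  defines "\<beta> \<equiv> bwd i" and "\<alpha> \<equiv> 1 - bwd (nx i)"
  shows "\<beta> > 0" "\<alpha> > 0" "min \<alpha> \<beta> > 0" "\<beta> - min \<alpha> \<beta> \<ge> 0" "\<alpha> - min \<alpha> \<beta> \<ge> 0"
  using bwd_bounds[of i] bwd_bounds[of "nx i"] assms by auto

lemma cost_mono:
  assumes i: "i < n" and "y \<le> y'" "S \<le> S'" "T \<le> T'" "Q \<le> Q'"
  shows "cost i y S T Q \<le> cost i y' S' T' Q'"
  unfolding cost_def Let_def
  by (intro min.mono add_mono mult_left_mono assms less_imp_le[OF weights(1)[OF i]]
      less_imp_le[OF weights(2)[OF i]] less_imp_le[OF weights(3)[OF i]] weights(4)[OF i] weights(5)[OF i])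

text \<open>Weak Kantorovich duality. Increments of \<open>f\<close> add up along the window, so
  both plans in \<open>cost\<close> assign them the same value, the difference of the jumps;
  \<open>cost_mono\<close> then replaces increments by distances.\<close>

lemma jump_diff_le_W1:
  assumes d: "pseudometric d" and f: "lipschitz1 d f" and i: "i < n"
  shows "jump f (nx i) - jump f i \<le> W1 d i"
proof -
  have lip: "f v - f u \<le> d u v" if "u < n" "v < n" for u v
    using f d that unfolding lipschitz1_def pseudometric_def by (metis atLeastLessThan_iff zero_le)
  have "jump f (nx i) - jump f i = cost i (f (nx i) - f i) (f (nx i) - f (pv i))
      (f (nx (nx i)) - f i) (f (nx (nx i)) - f (pv i))"
    using jump_diff[OF i, of f] by (simp add: cost_def Let_def algebra_simps)
  also have "\<dots> \<le> W1 d i"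
    unfolding W1_def using i by (intro cost_mono lip) auto
  finally show ?thesis .
qed

text \<open>McShane extension: the lower envelope of the cones \<open>g u + d u v\<close> with apex
  \<open>u \<in> A\<close>.\<close>

lemma lipschitz1_extension:
  assumes d: "pseudometric d" and A: "A \<subseteq> V" "A \<noteq> {}"
    and g: "\<And>u v. u \<in> A \<Longrightarrow> v \<in> A \<Longrightarrow> g u - g v \<le> d u v"
  obtains f where "lipschitz1 d f" "\<And>u. u \<in> A \<Longrightarrow> f u = g u"
proof
  define f where "f v = Min ((\<lambda>u. g u + d u v) ` A)" for v
  have fin: "finite A" using A finite_subset by blast
  have le: "f v \<le> g u + d u v" if "u \<in> A" for u v
    unfolding f_def using fin that by (intro Min_le) auto
  show "lipschitz1 d f"
    unfolding lipschitz1_def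
  proof (intro ballI)
    fix u v assume uv: "u \<in> V" "v \<in> V"
    have "f v \<in> (\<lambda>u. g u + d u v) ` A"
      unfolding f_def using fin A by (intro Min_in) auto
    then obtain a where a: "a \<in> A" "f v = g a + d a v" by auto
    have "d a u \<le> d a v + d v u" "d v u = d u v"
      using d a A uv unfolding pseudometric_def by blast+
    then show "f u - f v \<le> d u v" using a le[of a u] by simp
  qed
  show "f u = g u" if u: "u \<in> A" for u
  proof (rule antisym)
    have "d u u = 0" using d u A by (auto simp: pseudometric_def)
    then show "f u \<le> g u" using le[OF u, of u] by simp
    have "g u \<le> g a + d a u" if a: "a \<in> A" for a
    proof -
      have "d u a = d a u" using d u a A unfolding pseudometric_def by blast
      then show ?thesis using g[OF u a] by simp
    qed
    then show "g u \<le> f u"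
      unfolding f_def using fin A by (subst Min_ge_iff) auto
  qed
qed

text \<open>Strong duality, with \<open>f\<close> moreover tight on the edge itself, as the
  definition of curvature demands. Only the values on the four vertices of the window matter; the
  remaining ones come from the extension.\<close>

lemma W1_attained:
  assumes d: "pseudometric d" and i: "i < n"
  obtains f where "lipschitz1 d f" "f (nx i) - f i = d i (nx i)" "jump f (nx i) - jump f i = W1 d i"
proof -
  define \<beta> \<alpha> m where "\<beta> = bwd i" and "\<alpha> = 1 - bwd (nx i)" and "m = min \<alpha> \<beta>"
  define y S T Q where "y = d i (nx i)" and "S = d (pv i) (nx i)"
    and "T = d i (nx (nx i))" and "Q = d (pv i) (nx (nx i))"
  define x z where "x = d (pv i) i" and "z = d (nx i) (nx (nx i))"
  define A where "A = {pv i, i, nx i, nx (nx i)}"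
  have AV: "A \<subseteq> V" using i by (auto simp: A_def)
  note D = nx_pv_distinct[OF i]
  have V: "pv i \<in> V" "i \<in> V" "nx i \<in> V" "nx (nx i) \<in> V" using i by auto
  have sym: "d u v = d v u" and nonneg: "d u v \<ge> 0" if "u \<in> V" "v \<in> V" for u v
    using d that unfolding pseudometric_def by blast+
  have tri: "d u v \<le> d u w + d w v" if "u \<in> V" "v \<in> V" "w \<in> V" for u v w
    using d that unfolding pseudometric_def by blast
  have refl: "d u u = 0" if "u \<in> V" for u
    using d that unfolding pseudometric_def by blast
  have dx: "d i (pv i) = x" "d (pv i) i = x" "d i (nx i) = y" "d (nx i) i = y"
    "d (nx i) (nx (nx i)) = z" "d (nx (nx i)) (nx i) = z" "d (pv i) (nx i) = S" "d (nx i) (pv i) = S"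
    "d i (nx (nx i)) = T" "d (nx (nx i)) i = T" "d (pv i) (nx (nx i)) = Q" "d (nx (nx i)) (pv i) = Q"
    unfolding x_def y_def z_def S_def T_def Q_def
    by (simp_all only: sym[OF V(2) V(1)] sym[OF V(3) V(2)] sym[OF V(4) V(3)] sym[OF V(3) V(1)]
        sym[OF V(4) V(2)] sym[OF V(4) V(1)])
  note tris = tri[OF V(1) V(3) V(2)] tri[OF V(1) V(2) V(3)] tri[OF V(2) V(3) V(1)]
    tri[OF V(2) V(4) V(3)] tri[OF V(2) V(3) V(4)] tri[OF V(3) V(4) V(2)]
    tri[OF V(1) V(4) V(2)] tri[OF V(2) V(4) V(1)] tri[OF V(1) V(2) V(4)]
    tri[OF V(1) V(4) V(3)] tri[OF V(1) V(3) V(4)] tri[OF V(3) V(4) V(1)]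
    nonneg[OF V(1) V(2)] nonneg[OF V(2) V(3)] nonneg[OF V(3) V(4)]
    nonneg[OF V(1) V(3)] nonneg[OF V(2) V(4)] nonneg[OF V(1) V(4)]
  note tris = tris[unfolded dx]
  \<comment> \<open>Normalise \<open>f\<close> to 0 at \<open>i\<close> and \<open>y\<close> at
    \<open>nx i\<close>; then \<open>s\<close> and \<open>t\<close> are its increments over the two
    pairs two edges apart. The inequalities are the Lipschitz conditions between the four
    vertices.\<close>
  have extend: "\<exists>f. lipschitz1 d f \<and> f (nx i) - f i = y \<and>
      jump f (nx i) - jump f i = \<beta> * s + \<alpha> * t"
    if st: "s \<le> S" "- s \<le> S" "t \<le> T" "- t \<le> T" "s - y \<le> x" "y - s \<le> x" "t - y \<le> z" "y - t \<le> z"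
      "s + t - y \<le> Q" "y - s - t \<le> Q" for s t
  proof -
    define g where "g v = (if v = i then 0 else if v = nx i then y
      else if v = pv i then y - s else t)" for v
    have gv: "g i = 0" "g (nx i) = y" "g (pv i) = y - s" "g (nx (nx i)) = t"
      using D by (auto simp: g_def)
    have "\<forall>u\<in>A. \<forall>v\<in>A. g u - g v \<le> d u v"
      unfolding A_def ball_simps gv dx refl[OF V(1)] refl[OF V(2)] refl[OF V(3)] refl[OF V(4)]
      using st tris(13-18) by (intro conjI TrueI) linarith+
    then obtain f where f: "lipschitz1 d f" "\<And>u. u \<in> A \<Longrightarrow> f u = g u"
      using lipschitz1_extension[OF d AV, of g] A_def by blast
    have "f i = 0" "f (nx i) = y" "f (pv i) = y - s" "f (nx (nx i)) = t"
      using f(2) gv by (auto simp: A_def)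
    then show ?thesis
      using f(1) jump_diff[OF i, of f] by (intro exI[of _ f]) (simp add: \<alpha>_def \<beta>_def)
  qed
  have "\<exists>s t. s \<le> S \<and> - s \<le> S \<and> t \<le> T \<and> - t \<le> T \<and> s - y \<le> x \<and> y - s \<le> x \<and>
      t - y \<le> z \<and> y - t \<le> z \<and> s + t - y \<le> Q \<and> y - s - t \<le> Q \<and>
      \<beta> * s + \<alpha> * t = W1 d i"
  proof -
    have m: "m > 0" using weights(3)[OF i] by (simp add: m_def \<alpha>_def \<beta>_def)
    have W1: "W1 d i = min (\<beta> * S + \<alpha> * T) (\<beta> * S + \<alpha> * T - m * (S + T - y - Q))"
      by (simp add: W1_def cost_def Let_def \<alpha>_def \<beta>_def m_def S_def T_def Q_def y_def algebra_simps)
    \<comment> \<open>The choice \<open>s = S\<close>, \<open>t = T\<close> is optimal when the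
      outer pair permits it. Otherwise the increment with the smaller weight is lowered until the
      outer constraint is tight.\<close>
    consider "S + T - y \<le> Q" | "S + T - y > Q" "m = \<alpha>" | "S + T - y > Q" "m = \<beta>"
      unfolding m_def by linarith
    then show ?thesis
    proof cases
      case 1
      then have "m * (S + T - y - Q) \<le> 0"
        using m by (simp add: mult_le_0_iff)
      then have "W1 d i = \<beta> * S + \<alpha> * T" using W1 by simp
      then show ?thesis
        using 1 tris by (intro exI[of _ S] exI[of _ T] conjI) linarith+
    next
      case 2
      then have "m * (S + T - y - Q) > 0" using m by simp
      then have "\<beta> * S + \<alpha> * (Q + y - S) = W1 d i" using W1 2 by (simp add: algebra_simps)
      then show ?thesis
        using 2 tris by (intro exI[of _ S] exI[of _ "Q + y - S"] conjI) linarith+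
    next
      case 3
      then have "m * (S + T - y - Q) > 0" using m by simp
      then have "\<beta> * (Q + y - T) + \<alpha> * T = W1 d i" using W1 3 by (simp add: algebra_simps)
      then show ?thesis
        using 3 tris by (intro exI[of _ "Q + y - T"] exI[of _ T] conjI) linarith+
    qed
  qed
  then obtain s t where "s \<le> S" "- s \<le> S" "t \<le> T" "- t \<le> T" "s - y \<le> x" "y - s \<le> x"
      "t - y \<le> z" "y - t \<le> z" "s + t - y \<le> Q" "y - s - t \<le> Q" "\<beta> * s + \<alpha> * t = W1 d i"
    by blast
  with extend[of s t] show thesis using that unfolding y_def by auto
qed

lemma W1_nonneg:
  assumes "pseudometric d" "i < n"
  shows "0 \<le> W1 d i"
proof -
  have "lipschitz1 d (\<lambda>_. 0)" using assms by (auto simp: lipschitz1_def pseudometric_def)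
  from jump_diff_le_W1[OF assms(1) this assms(2)] show ?thesis
    by (simp add: jump_def laplacian_def)
qed

text \<open>For \<open>f\<close> optimal at edge \<open>i\<close>, test all other edges with
  \<open>- f\<close>: the differences of jumps telescope around the cycle. This is the polygon
  inequality for costs, by which \<open>step\<close> will preserve
  \<open>admissible\<close>.\<close>

lemma W1_le_sum:
  assumes d: "pseudometric d" and i: "i < n"
  shows "2 * W1 d i \<le> (\<Sum>k\<in>V. W1 d k)"
proof -
  obtain f where f: "lipschitz1 d f" "jump f (nx i) - jump f i = W1 d i"
    using W1_attained[OF d i] by blast
  have neg: "lipschitz1 d (\<lambda>v. - f v)"
    unfolding lipschitz1_def
  proof (intro ballI)
    fix u v assume "u \<in> V" "v \<in> V"
    then have "f v - f u \<le> d v u" "d v u = d u v"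
      using f(1) d unfolding lipschitz1_def pseudometric_def by blast+
    then show "- f u - - f v \<le> d u v" by simp
  qed
  have "jump (\<lambda>v. - f v) k = - jump f k" for k
    by (simp add: jump_def laplacian_def right_diff_distrib sum_subtractf sum_negf)
  then have "jump f k - jump f (nx k) \<le> W1 d k" if "k < n" for k
    using jump_diff_le_W1[OF d neg that] by simp
  then have "(\<Sum>k\<in>V - {i}. jump f k - jump f (nx k)) \<le> (\<Sum>k\<in>V - {i}. W1 d k)"
    by (intro sum_mono) auto
  moreover have "(\<Sum>k\<in>V. jump f k - jump f (nx k)) = 0"
    using sum_nx[of "jump f"] by (simp add: sum_subtractf)
  ultimately show ?thesis
    using i f(2) by (simp add: sum_diff1)
qed


section \<open>Ollivier curvature in terms of the transport cost\<close>

lemma laplacian_minus: "laplacian V p (\<lambda>v. - f v) = (\<lambda>v. - laplacian V p f v)"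
  by (simp add: fun_eq_iff laplacian_def right_diff_distrib sum_subtractf sum_negf)

text \<open>Replacing \<open>f\<close> by \<open>- f\<close> maps each of the two sets under the
  infimum into the other.\<close>

lemma ollivier_curvature_sym:
  assumes "d x y = d y x"
  shows "ollivier_curvature V p d x y = ollivier_curvature V p d y x"
proof -
  have g: "grad d u v (\<lambda>w. - f w) = - grad d u v f" for u v f
    by (simp add: grad_def minus_divide_left)
  let ?A = "\<lambda>x y. {grad d x y (laplacian V p f) | f. grad d y x f = 1 \<and>
    Sup {\<bar>grad d u v f\<bar> | u v. u \<in> V \<and> v \<in> V \<and> u \<noteq> v} = 1}"
  have "?A x y \<subseteq> ?A y x" if "d x y = d y x" for x y
  proof
    fix k assume "k \<in> ?A x y"
    then obtain f where f: "k = grad d x y (laplacian V p f)" "grad d y x f = 1"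
      "Sup {\<bar>grad d u v f\<bar> | u v. u \<in> V \<and> v \<in> V \<and> u \<noteq> v} = 1" by blast
    have "grad d y x h = - grad d x y h" for h
      using that by (simp add: grad_def minus_divide_left)
    then have "grad d x y (\<lambda>w. - f w) = 1" "grad d y x (laplacian V p (\<lambda>w. - f w)) = k"
      using f(1,2) by (simp_all add: laplacian_minus g)
    then show "k \<in> ?A y x" using f(3) by (intro CollectI exI[of _ "\<lambda>w. - f w"]) (simp add: g)
  qed
  then show ?thesis
    unfolding ollivier_curvature_def using assms by (metis (lifting) subset_antisym)
qed

lemma lipschitz1_if_Sup_grad:
  assumes d: "pseudometric d" and pos: "\<And>x y. x < n \<Longrightarrow> y < n \<Longrightarrow> x \<noteq> y \<Longrightarrow> d x y > 0"
    and Sup: "Sup {\<bar>grad d u v f\<bar> | u v. u \<in> V \<and> v \<in> V \<and> u \<noteq> v} = 1"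
  shows "lipschitz1 d f"
  unfolding lipschitz1_def
proof (intro ballI)
  fix u v assume uv: "u \<in> V" "v \<in> V"
  let ?G = "{\<bar>grad d u v f\<bar> | u v. u \<in> V \<and> v \<in> V \<and> u \<noteq> v}"
  show "f u - f v \<le> d u v"
  proof (cases "u = v")
    case True
    then show ?thesis using d uv by (auto simp: pseudometric_def)
  next
    case False
    \<comment> \<open>There are only finitely many gradients, so \<open>Sup\<close> is a genuine
      upper bound.\<close>
    have "?G \<subseteq> (\<lambda>(u, v). \<bar>grad d u v f\<bar>) ` (V \<times> V)" by auto
    then have "bdd_above ?G"
      by (meson bdd_above_finite finite_SigmaI finite_atLeastLessThan finite_imageI finite_subset)
    then have "\<bar>grad d u v f\<bar> \<le> 1"
      unfolding Sup[symmetric] using uv False by (intro cSup_upper) auto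
    moreover have "d u v > 0" using pos uv False by simp
    ultimately show ?thesis by (simp add: grad_def divide_simps)
  qed
qed

lemma Sup_grad_if_lipschitz1:
  assumes d: "pseudometric d" and f: "lipschitz1 d f" and ab: "a < n" "b < n" "a \<noteq> b" "grad d a b f = 1"
  shows "Sup {\<bar>grad d u v f\<bar> | u v. u \<in> V \<and> v \<in> V \<and> u \<noteq> v} = 1"
proof (rule cSup_eq_maximum)
  show "1 \<in> {\<bar>grad d u v f\<bar> | u v. u \<in> V \<and> v \<in> V \<and> u \<noteq> v}"
    using ab by (intro CollectI exI[of _ a] exI[of _ b]) simp
next
  fix k assume "k \<in> {\<bar>grad d u v f\<bar> | u v. u \<in> V \<and> v \<in> V \<and> u \<noteq> v}"
  then obtain u v where uv: "k = \<bar>grad d u v f\<bar>" "u \<in> V" "v \<in> V" by blast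
  have "f u - f v \<le> d u v" "f v - f u \<le> d v u" "d v u = d u v" "d u v \<ge> 0"
    using f d uv unfolding lipschitz1_def pseudometric_def by blast+
  then have "\<bar>f u - f v\<bar> \<le> d u v" by linarith
  then show "k \<le> 1" using \<open>d u v \<ge> 0\<close> by (auto simp: uv grad_def abs_divide divide_simps)
qed

text \<open>As \<open>f\<close> rises by exactly \<open>d i (nx i)\<close> along the edge, the term
  \<open>2 * f i\<close> of \<open>jump\<close> contributes the constant 2. The rest is Kantorovich
  duality, and the infimum is attained.\<close>

lemma ollivier_curvature_eq:
  assumes d: "pseudometric d" and pos: "\<And>x y. x < n \<Longrightarrow> y < n \<Longrightarrow> x \<noteq> y \<Longrightarrow> d x y > 0"
    and i: "i < n"
  shows "ollivier_curvature V p d i (nx i) = 2 - W1 d i / d i (nx i)"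
proof -
  define y where "y = d i (nx i)"
  have y: "y > 0" "d (nx i) i = y"
    using pos[of i "nx i"] i nx_pv_distinct(1)[OF i] d by (auto simp: y_def pseudometric_def)
  have grad_eq: "grad d i (nx i) (laplacian V p f) = 2 - (jump f (nx i) - jump f i) / y"
    if "grad d (nx i) i f = 1" for f
  proof -
    have "f (nx i) - f i = y" using that y by (simp add: grad_def)
    then have "laplacian V p f i - laplacian V p f (nx i) = 2 * y - (jump f (nx i) - jump f i)"
      by (simp add: jump_def)
    then show ?thesis using y(1) by (simp add: grad_def diff_divide_distrib flip: y_def)
  qed
  show ?thesis
    unfolding ollivier_curvature_def y_def[symmetric]
  proof (rule cInf_eq_minimum)
    obtain f where f: "lipschitz1 d f" "f (nx i) - f i = d i (nx i)" "jump f (nx i) - jump f i = W1 d i"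
      using W1_attained[OF d i] by blast
    have g1: "grad d (nx i) i f = 1" using f(2) y by (simp add: grad_def y_def)
    then have "Sup {\<bar>grad d u v f\<bar> | u v. u \<in> V \<and> v \<in> V \<and> u \<noteq> v} = 1"
      using Sup_grad_if_lipschitz1[OF d f(1), of "nx i" i] i nx_pv_distinct(1)[OF i] by simp
    then show "2 - W1 d i / y \<in> {grad d i (nx i) (laplacian V p f) | f. grad d (nx i) i f = 1 \<and>
        Sup {\<bar>grad d u v f\<bar> | u v. u \<in> V \<and> v \<in> V \<and> u \<noteq> v} = 1}"
      using g1 grad_eq[OF g1] f(3) by (intro CollectI exI[of _ f]) simp
  next
    fix k assume "k \<in> {grad d i (nx i) (laplacian V p f) | f. grad d (nx i) i f = 1 \<and>
        Sup {\<bar>grad d u v f\<bar> | u v. u \<in> V \<and> v \<in> V \<and> u \<noteq> v} = 1}"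
    then obtain f where f: "k = grad d i (nx i) (laplacian V p f)" "grad d (nx i) i f = 1"
        "Sup {\<bar>grad d u v f\<bar> | u v. u \<in> V \<and> v \<in> V \<and> u \<noteq> v} = 1" by blast
    have "jump f (nx i) - jump f i \<le> W1 d i"
      by (rule jump_diff_le_W1[OF d lipschitz1_if_Sup_grad[OF d pos f(3)] i])
    then show "2 - W1 d i / y \<le> k"
      using grad_eq[OF f(2)] f(1) y(1) by (simp add: divide_right_mono)
  qed
qed

section \<open>Circle metrics and path distances\<close>

definition pos :: "(nat \<Rightarrow> real) \<Rightarrow> nat \<Rightarrow> real" where "pos w i = (\<Sum>k<i. w k)"

abbreviation total :: "(nat \<Rightarrow> real) \<Rightarrow> real" where "total w \<equiv> (\<Sum>k\<in>V. w k)"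

text \<open>Vertices sit at the coordinates \<open>pos w\<close> on a circle of circumference
  \<open>total w\<close>; the distance is the shorter of the two arcs.\<close>

definition circle :: "(nat \<Rightarrow> real) \<Rightarrow> nat \<Rightarrow> nat \<Rightarrow> real" where
  "circle w x y = min \<bar>pos w x - pos w y\<bar> (total w - \<bar>pos w x - pos w y\<bar>)"

lemma pos_0 [simp]: "pos w 0 = 0"
  by (simp add: pos_def)

lemma pos_Suc: "pos w (Suc i) = pos w i + w i"
  by (simp add: pos_def)

lemma pos_n: "pos w n = total w"
  by (simp add: pos_def lessThan_atLeast0)

lemma pos_nx: "i < n \<Longrightarrow> pos w (nx i) = pos w i + w i - (if Suc i = n then total w else 0)"
  using pos_Suc[of w i] pos_n[of w] by (auto simp: nx_def)

lemma pos_mono: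
  assumes "\<And>i. i < n \<Longrightarrow> w i \<ge> 0" "x \<le> y" "y \<le> n"
  shows "pos w x \<le> pos w y"
  unfolding pos_def using assms by (intro sum_mono2) auto

lemma pos_strict_mono:
  assumes "\<And>i. i < n \<Longrightarrow> w i > 0" "x < y" "y \<le> n"
  shows "pos w x < pos w y"
  unfolding pos_def using assms by (intro sum_strict_mono2[where b = x]) (auto simp: less_imp_le)

lemma pos_bounds:
  assumes "\<And>i. i < n \<Longrightarrow> w i \<ge> 0" "x < n"
  shows "0 \<le> pos w x" "pos w x \<le> total w"
  using pos_mono[of w 0 x] pos_mono[of w x n] assms pos_n by auto

lemma circle_pseudometric:
  assumes w: "\<And>i. i < n \<Longrightarrow> w i \<ge> 0"
  shows "pseudometric (circle w)"
proof -
  have L: "total w \<ge> 0" using w by (intro sum_nonneg) auto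
  have pb: "0 \<le> pos w u" "pos w u \<le> total w" if "u < n" for u
    using pos_bounds[of w u] w that by auto
  have "circle w x x = 0" for x
    using L by (simp add: circle_def)
  moreover have "circle w x y \<ge> 0" if "x < n" "y < n" for x y
    using pb[of x] pb[of y] that by (simp add: circle_def abs_le_iff)
  moreover have "circle w x y = circle w y x" for x y
    by (simp add: circle_def abs_minus_commute)
  moreover have "circle w x z \<le> circle w x y + circle w y z" if "x < n" "y < n" "z < n" for x y z
    using pb[of x] pb[of y] pb[of z] that unfolding circle_def min_def abs_if by simp
  ultimately show ?thesis by (auto simp: pseudometric_def)
qed

lemma circle_pos:
  assumes w: "\<And>i. i < n \<Longrightarrow> w i > 0" and "x < n" "y < n" "x \<noteq> y"
  shows "circle w x y > 0"
proof -
  have "pos w x \<noteq> pos w y"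
    using pos_strict_mono[of w x y] pos_strict_mono[of w y x] assms
    by (cases x y rule: linorder_cases) auto
  moreover have "0 \<le> pos w x" "pos w x < total w" "0 \<le> pos w y" "pos w y < total w"
    using pos_bounds(1)[of w] pos_strict_mono[of w x n] pos_strict_mono[of w y n] assms pos_n
    by (auto simp: less_imp_le)
  ultimately show ?thesis by (auto simp: circle_def)
qed

text \<open>\<open>A\<close> is the length of the forward arc from \<open>x\<close> to
  \<open>y\<close>; the second alternative covers an arc crossing the edge from \<open>n - 1\<close>
  to 0.\<close>

lemma circle_arc:
  assumes "0 \<le> A" "A \<le> total w" "pos w y - pos w x = A \<or> pos w y - pos w x = A - total w"
  shows "circle w x y = min A (total w - A)"
  using assms unfolding circle_def min_def abs_if by auto

lemma circle_nx:
  assumes w: "\<And>i. i < n \<Longrightarrow> w i \<ge> 0" and i: "i < n"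
  shows "circle w i (nx i) = min (w i) (total w - w i)"
proof (rule circle_arc)
  show "w i \<le> total w" using w i by (intro member_le_sum) auto
qed (use w i pos_nx[of i w] in auto)

lemma sum_window:
  assumes "i < n"
  shows "total w = w (pv i) + w i + w (nx i) + (\<Sum>k\<in>V - {pv i, i, nx i}. w k)"
proof -
  have "total w = (\<Sum>k\<in>{pv i, i, nx i}. w k) + (\<Sum>k\<in>V - {pv i, i, nx i}. w k)"
    by (subst sum.subset_diff[of "{pv i, i, nx i}" V]) (use assms in auto)
  then show ?thesis using nx_pv_distinct[OF assms] by simp
qed

lemma circle_window:
  assumes w: "\<And>i. i < n \<Longrightarrow> w i \<ge> 0" and i: "i < n"
  defines "x \<equiv> w (pv i)" and "y \<equiv> w i" and "z \<equiv> w (nx i)" and "L \<equiv> total w"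
  shows "circle w (pv i) (nx i) = min (x + y) (L - (x + y))"
    "circle w i (nx (nx i)) = min (y + z) (L - (y + z))"
    "circle w (pv i) (nx (nx i)) = min (x + y + z) (L - (x + y + z))"
proof -
  have "(\<Sum>k\<in>V - {pv i, i, nx i}. w k) \<ge> 0" using w by (intro sum_nonneg) auto
  moreover have "x \<ge> 0" "y \<ge> 0" "z \<ge> 0" using w i by (auto simp: x_def y_def z_def)
  ultimately have L: "x + y + z \<le> L" "x \<ge> 0" "y \<ge> 0" "z \<ge> 0"
    using sum_window[OF i, of w] by (simp_all add: x_def y_def z_def L_def)
  \<comment> \<open>At most one of the three edges is the edge from \<open>n - 1\<close> to 0, so at
    most one of the positions below is corrected by \<open>L\<close>.\<close>
  have Suc: "Suc (pv i) = n \<or> Suc i = n \<or> Suc (nx i) = n \<Longrightarrow>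
     (Suc (pv i) = n \<and> Suc i \<noteq> n \<and> Suc (nx i) \<noteq> n) \<or>
     (Suc (pv i) \<noteq> n \<and> Suc i = n \<and> Suc (nx i) \<noteq> n) \<or>
     (Suc (pv i) \<noteq> n \<and> Suc i \<noteq> n \<and> Suc (nx i) = n)"
    using i n5 by (auto simp: nx_def pv_def split: if_splits)
  have pos: "pos w i = pos w (pv i) + x - (if Suc (pv i) = n then L else 0)"
    "pos w (nx i) = pos w i + y - (if Suc i = n then L else 0)"
    "pos w (nx (nx i)) = pos w (nx i) + z - (if Suc (nx i) = n then L else 0)"
    using pos_nx[of "pv i" w] pos_nx[of i w] pos_nx[of "nx i" w] i
    by (simp_all add: x_def y_def z_def L_def)
  show "circle w (pv i) (nx i) = min (x + y) (L - (x + y))"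
    unfolding L_def by (rule circle_arc) (use L pos Suc in \<open>auto simp: L_def split: if_splits\<close>)
  show "circle w i (nx (nx i)) = min (y + z) (L - (y + z))"
    unfolding L_def by (rule circle_arc) (use L pos Suc in \<open>auto simp: L_def split: if_splits\<close>)
  show "circle w (pv i) (nx (nx i)) = min (x + y + z) (L - (x + y + z))"
    unfolding L_def by (rule circle_arc) (use L pos Suc in \<open>auto simp: L_def split: if_splits\<close>)
qed

end

section \<open>Walks and their lengths\<close>

lemma walk_successively:
  "walk V p xs \<longleftrightarrow> xs \<noteq> [] \<and> set xs \<subseteq> V \<and> successively (adj V p) xs"
  by (auto simp: walk_def successively_conv_nth)

lemma walk_length_singleton [simp]: "walk_length d [x] = 0"
  by (simp add: walk_length_def)

lemma walk_length_Cons [simp]: "walk_length d (x # y # zs) = d x y + walk_length d (y # zs)"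
  by (simp add: walk_length_def sum.lessThan_Suc_shift del: sum.lessThan_Suc)

lemma walk_length_append:
  "xs \<noteq> [] \<Longrightarrow> ys \<noteq> [] \<Longrightarrow>
    walk_length d (xs @ ys) = walk_length d xs + d (last xs) (hd ys) + walk_length d ys"
proof (induction xs)
  case (Cons x xs)
  then show ?case by (cases xs; cases ys) auto
qed simp

lemma walk_length_rev:
  assumes "\<And>x y. x \<in> set xs \<Longrightarrow> y \<in> set xs \<Longrightarrow> d x y = d y x"
  shows "walk_length d (rev xs) = walk_length d xs"
  using assms
proof (induction xs)
  case (Cons x xs)
  show ?case
  proof (cases xs)
    case (Cons y zs)
    then have "walk_length d (rev (x # xs)) = walk_length d (rev xs) + d y x"
      using walk_length_append[of "rev xs" "[x]" d] by simp
    then show ?thesis using Cons.IH Cons.prems Cons by simp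
  qed simp
qed simp

lemma walk_length_cong:
  assumes "walk V p xs" "\<And>x y. adj V p x y \<Longrightarrow> d x y = d' x y"
  shows "walk_length d xs = walk_length d' xs"
  unfolding walk_length_def using assms by (intro sum.cong) (auto simp: walk_def)

context cycle_chain begin

lemma walk_rev: "walk V p xs \<Longrightarrow> walk V p (rev xs)"
  by (auto simp: walk_successively elim!: successively_mono intro: adj_sym)

lemma dist_le_walk_length:
  assumes d: "pseudometric d"
  shows "xs \<noteq> [] \<Longrightarrow> set xs \<subseteq> V \<Longrightarrow> d (hd xs) (last xs) \<le> walk_length d xs"
proof (induction xs)
  case (Cons x xs)
  show ?case
  proof (cases xs)
    case Nil
    then show ?thesis using Cons.prems d by (simp add: pseudometric_def)
  next
    case (Cons y zs)
    have "x \<in> V" "y \<in> V" "last xs \<in> V" using Cons.prems Cons by (auto simp: subset_iff)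
    then have "d x (last xs) \<le> d x y + d y (last xs)" using d unfolding pseudometric_def by blast
    moreover have "d y (last xs) \<le> walk_length d xs" using Cons.IH Cons.prems Cons by simp
    ultimately show ?thesis using Cons by simp
  qed
qed simp

lemma walk_upt:
  assumes "x \<le> y" "y < n"
  shows "walk V p [x..<Suc y]"
  using assms by (auto simp: walk_def adj_iff nx_def simp del: upt_Suc)

lemma walk_length_upt:
  assumes "\<And>i. i < n \<Longrightarrow> d i (nx i) = w i" "x \<le> y" "y < n"
  shows "walk_length d [x..<Suc y] = pos w y - pos w x"
proof -
  have "walk_length d [x..<Suc y] = (\<Sum>k<y - x. d (x + k) (Suc (x + k)))"
    unfolding walk_length_def by (intro sum.cong) (auto simp del: upt_Suc)
  also have "\<dots> = (\<Sum>k<y - x. pos w (x + Suc k) - pos w (x + k))"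
  proof (rule sum.cong)
    fix k assume "k \<in> {..<y - x}"
    then have "x + k < n" "Suc (x + k) \<noteq> n" using assms by auto
    then have "d (x + k) (Suc (x + k)) = w (x + k)" using assms(1)[of "x + k"] by (simp add: nx_def)
    then show "d (x + k) (Suc (x + k)) = pos w (x + Suc k) - pos w (x + k)" by (simp add: pos_Suc)
  qed simp
  also have "\<dots> = pos w y - pos w x"
    using assms by (subst sum_lessThan_telescope) simp
  finally show ?thesis .
qed

text \<open>One walk for each arc, constructed for \<open>x \<le> y\<close> and otherwise reversed,
  which keeps the length as \<open>d\<close> is symmetric.\<close>

lemma walks_both_ways:
  assumes w: "\<And>i. i < n \<Longrightarrow> w i \<ge> 0" "\<And>i. i < n \<Longrightarrow> d i (nx i) = w i"
    and sym: "\<And>x y. x < n \<Longrightarrow> y < n \<Longrightarrow> d x y = d y x"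
    and xy: "x < n" "y < n"
  shows "\<exists>xs. walk V p xs \<and> hd xs = x \<and> last xs = y \<and> walk_length d xs = \<bar>pos w x - pos w y\<bar>"
    "\<exists>xs. walk V p xs \<and> hd xs = x \<and> last xs = y \<and> walk_length d xs = total w - \<bar>pos w x - pos w y\<bar>"
proof -
  have le: "(\<exists>xs. walk V p xs \<and> hd xs = x \<and> last xs = y \<and> walk_length d xs = \<bar>pos w x - pos w y\<bar>) \<and>
    (\<exists>xs. walk V p xs \<and> hd xs = x \<and> last xs = y \<and> walk_length d xs = total w - \<bar>pos w x - pos w y\<bar>)"
    if xy: "x \<le> y" "y < n" for x y
  proof
    have pos: "\<bar>pos w x - pos w y\<bar> = pos w y - pos w x"
      using pos_mono[of w x y] w xy by auto
    have "walk_length d [x..<Suc y] = pos w y - pos w x"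
      using walk_length_upt[of d w x y] w xy by blast
    then show "\<exists>xs. walk V p xs \<and> hd xs = x \<and> last xs = y \<and> walk_length d xs = \<bar>pos w x - pos w y\<bar>"
      using walk_upt[OF xy] pos xy by (intro exI[of _ "[x..<Suc y]"]) (simp add: last_upt del: upt_Suc)
    \<comment> \<open>The complementary arc goes down from \<open>x\<close> to 0, across to
      \<open>n - 1\<close>, and down to \<open>y\<close>. The bound \<open>Suc (n - 1)\<close> has
      the shape needed by \<open>walk_upt\<close>.\<close>
    let ?A = "[0..<Suc x]" and ?B = "[y..<Suc (n - 1)]"
    have n: "Suc (n - 1) = n" using n5 by simp
    have "nx (n - 1) = 0" "adj V p 0 (n - 1)" using n5 by (auto simp: adj_iff pv_def nx_def)
    then have "walk V p (rev ?A @ rev ?B)"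
      using walk_rev[OF walk_upt[of 0 x]] walk_rev[OF walk_upt[of y "n - 1"]] xy n5
      by (auto simp: walk_successively successively_append_iff last_rev hd_rev simp del: upt_Suc)
    moreover have "walk_length d (rev ?A @ rev ?B) = total w - (pos w y - pos w x)"
    proof -
      have "walk_length d (rev ?A) = walk_length d ?A" "walk_length d (rev ?B) = walk_length d ?B"
        using xy n5 by (auto intro!: walk_length_rev sym simp del: upt_Suc)
      moreover have "walk_length d ?A = pos w x - pos w 0"
        using walk_length_upt[of d w 0 x] w xy by auto
      moreover have "walk_length d ?B = pos w (n - 1) - pos w y"
        using walk_length_upt[of d w y "n - 1"] w xy n5 by auto
      moreover have "d 0 (n - 1) = w (n - 1)"
        using w(2)[of "n - 1"] sym[of 0 "n - 1"] \<open>nx (n - 1) = 0\<close> n5 by simp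
      moreover have "pos w (n - 1) + w (n - 1) = total w"
        using pos_Suc[of w "n - 1"] n pos_n[of w] by simp
      ultimately show ?thesis
        using xy n5 by (simp add: walk_length_append last_rev hd_rev del: upt_Suc)
    qed
    ultimately show "\<exists>xs. walk V p xs \<and> hd xs = x \<and> last xs = y \<and>
        walk_length d xs = total w - \<bar>pos w x - pos w y\<bar>"
      using pos xy n5
      by (intro exI[of _ "rev ?A @ rev ?B"]) (simp add: hd_append hd_rev last_rev del: upt_Suc)
  qed
  have reverse: "\<exists>xs. walk V p xs \<and> hd xs = x \<and> last xs = y \<and> walk_length d xs = l"
    if "walk V p xs" "hd xs = y" "last xs = x" "walk_length d xs = l" for xs l
  proof -
    have "set xs \<subseteq> V" "xs \<noteq> []" using that by (auto simp: walk_def)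
    then have "walk_length d (rev xs) = l"
      using that by (subst walk_length_rev) (auto intro!: sym)
    then show ?thesis
      using that walk_rev[OF that(1)] \<open>xs \<noteq> []\<close> by (intro exI[of _ "rev xs"]) (simp add: hd_rev last_rev)
  qed
  have "(\<exists>xs. walk V p xs \<and> hd xs = x \<and> last xs = y \<and> walk_length d xs = \<bar>pos w x - pos w y\<bar>) \<and>
    (\<exists>xs. walk V p xs \<and> hd xs = x \<and> last xs = y \<and> walk_length d xs = total w - \<bar>pos w x - pos w y\<bar>)"
  proof (cases "x \<le> y")
    case True
    then show ?thesis using le xy by blast
  next
    case False
    then have "y \<le> x" by simp
    from le[OF this xy(1)] show ?thesis
      unfolding abs_minus_commute[of "pos w y" "pos w x"] using reverse by blast
  qed
  then show "\<exists>xs. walk V p xs \<and> hd xs = x \<and> last xs = y \<and> walk_length d xs = \<bar>pos w x - pos w y\<bar>"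
    "\<exists>xs. walk V p xs \<and> hd xs = x \<and> last xs = y \<and> walk_length d xs = total w - \<bar>pos w x - pos w y\<bar>"
    by blast+
qed

text \<open>The polygon inequality: no edge exceeds the rest of the cycle, so by
  \<open>circle_nx\<close> each edge realises the distance of its ends.\<close>

definition admissible :: "(nat \<Rightarrow> real) \<Rightarrow> bool" where
  "admissible w \<longleftrightarrow> (\<forall>i<n. w i \<ge> 0 \<and> 2 * w i \<le> total w)"

lemma circle_nx_admissible: "admissible w \<Longrightarrow> i < n \<Longrightarrow> circle w i (nx i) = w i"
  using circle_nx[of w i] by (force simp: admissible_def)

text \<open>The triangle inequality bounds every walk from below, and the shorter of the two arcs
  attains the bound.\<close>

lemma circle_general_path_distance:
  assumes adm: "admissible w" and pos: "\<And>i. i < n \<Longrightarrow> w i > 0"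
  shows "general_path_distance V p (circle w)"
proof -
  have w: "\<And>i. i < n \<Longrightarrow> w i \<ge> 0" using pos by (simp add: less_imp_le)
  have pm: "pseudometric (circle w)" using circle_pseudometric[of w] w by blast
  have pm': "circle w x x = 0" "circle w x y \<ge> 0" "circle w x y = circle w y x" if "x < n" "y < n" for x y
    using pm that unfolding pseudometric_def by (metis atLeastLessThan_iff zero_le)+
  have "circle w x y = 0 \<longleftrightarrow> x = y" if "x < n" "y < n" for x y
    using circle_pos[of w x y] pos pm'[OF that] pm'[OF that(1) that(1)] that by force
  moreover have "Inf {walk_length (circle w) xs | xs. walk V p xs \<and> hd xs = x \<and> last xs = y} = circle w x y"
    if xy: "x < n" "y < n" for x y
  proof (rule cInf_eq_minimum)
    have "\<exists>xs. walk V p xs \<and> hd xs = x \<and> last xs = y \<and> walk_length (circle w) xs = circle w x y"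
      using walks_both_ways[of w "circle w" x y] w circle_nx_admissible[OF adm] pm'(3) xy
      unfolding circle_def[of w x y] min_def by presburger
    then show "circle w x y \<in> {walk_length (circle w) xs | xs. walk V p xs \<and> hd xs = x \<and> last xs = y}"
      by (metis (mono_tags, lifting) mem_Collect_eq)
  next
    fix l assume "l \<in> {walk_length (circle w) xs | xs. walk V p xs \<and> hd xs = x \<and> last xs = y}"
    then show "circle w x y \<le> l"
      using dist_le_walk_length[OF pm] by (auto simp: walk_def)
  qed
  ultimately show ?thesis using pm' by (auto simp: general_path_distance_def)
qed

text \<open>Both arcs bound \<open>d\<close> from above; for an edge, the way round yields the
  polygon inequality. From below, \<open>d\<close> and \<open>circle w\<close> agree on edges, hence
  on lengths of walks, and no walk is shorter than the \<open>circle w\<close> distance of its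
  ends.\<close>

lemma general_path_distance_eq_circle:
  assumes d: "general_path_distance V p d"
  defines "w \<equiv> \<lambda>i. d i (nx i)"
  shows "\<And>i. i < n \<Longrightarrow> w i > 0" "admissible w" "\<And>x y. x < n \<Longrightarrow> y < n \<Longrightarrow> d x y = circle w x y"
proof -
  have d': "d x y \<ge> 0" "d x y = d y x" "d x y = 0 \<longleftrightarrow> x = y"
    "d x y = Inf {walk_length d xs | xs. walk V p xs \<and> hd xs = x \<and> last xs = y}"
    if "x < n" "y < n" for x y
  proof -
    have "d x y \<ge> 0 \<and> d x y = d y x \<and> (d x y = 0 \<longleftrightarrow> x = y) \<and>
        d x y = Inf {walk_length d xs | xs. walk V p xs \<and> hd xs = x \<and> last xs = y}"
      by (rule d[unfolded general_path_distance_def, THEN bspec, THEN bspec]) (use that in auto)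
    then show "d x y \<ge> 0" "d x y = d y x" "d x y = 0 \<longleftrightarrow> x = y"
      "d x y = Inf {walk_length d xs | xs. walk V p xs \<and> hd xs = x \<and> last xs = y}" by blast+
  qed
  show pos: "w i > 0" if "i < n" for i
    using d'(1,3)[of i "nx i"] that nx_pv_distinct(1)[OF that] by (fastforce simp: w_def)
  have w: "\<And>i. i < n \<Longrightarrow> w i \<ge> 0" using pos by (simp add: less_imp_le)
  have le: "d x y \<le> walk_length d xs" if "walk V p xs" "hd xs = x" "last xs = y" for xs x y
  proof -
    have xy: "x < n" "y < n" using that by (auto simp: walk_def subset_iff)
    have "bdd_below {walk_length d xs | xs. walk V p xs \<and> hd xs = x \<and> last xs = y}"
      by (rule bdd_belowI[of _ 0])
        (auto simp: walk_length_def walk_def adj_def intro!: sum_nonneg d'(1))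
    then show ?thesis
      unfolding d'(4)[OF xy] using that by (intro cInf_lower) auto
  qed
  have walks: "\<exists>xs. walk V p xs \<and> hd xs = x \<and> last xs = y \<and> walk_length d xs = \<bar>pos w x - pos w y\<bar>"
    "\<exists>xs. walk V p xs \<and> hd xs = x \<and> last xs = y \<and> walk_length d xs = total w - \<bar>pos w x - pos w y\<bar>"
    if "x < n" "y < n" for x y
    by (rule walks_both_ways; (rule w d'(2) that | simp add: w_def); assumption?)+
  have le_circle: "d x y \<le> circle w x y" "d x y \<le> total w - \<bar>pos w x - pos w y\<bar>"
    "d x y \<le> \<bar>pos w x - pos w y\<bar>" if "x < n" "y < n" for x y
    using walks[OF that] le by (fastforce simp: circle_def)+
  show adm: "admissible w"
    unfolding admissible_def
  proof (intro allI impI conjI)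
    fix i assume i: "i < n"
    show "0 \<le> w i" using w i by simp
    have "w i \<le> circle w i (nx i)"
      using le_circle[of i "nx i"] i by (simp add: w_def)
    then show "2 * w i \<le> total w" using circle_nx[of w i] w i by simp
  qed
  show "d x y = circle w x y" if xy: "x < n" "y < n" for x y
  proof (rule antisym)
    show "d x y \<le> circle w x y" using le_circle xy by simp
    have pm: "pseudometric (circle w)" using circle_pseudometric[of w] w by blast
    show "circle w x y \<le> d x y"
      unfolding d'(4)[OF xy]
    proof (rule cInf_greatest)
      show "{walk_length d xs | xs. walk V p xs \<and> hd xs = x \<and> last xs = y} \<noteq> {}"
        using walks(1)[OF xy] by blast
    next
      fix l assume "l \<in> {walk_length d xs | xs. walk V p xs \<and> hd xs = x \<and> last xs = y}"
      then obtain xs where xs: "l = walk_length d xs" "walk V p xs" "hd xs = x" "last xs = y" by blast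
      have edge: "d u v = circle w u v" if "adj V p u v" for u v
      proof -
        have "d i (nx i) = circle w i (nx i)" if "i < n" for i
          using circle_nx_admissible[OF adm that] by (simp add: w_def)
        moreover have "circle w a b = circle w b a" for a b
          by (simp add: circle_def abs_minus_commute)
        ultimately show ?thesis using that d'(2) by (metis adj_iff nx_pv pv_less nx_less)
      qed
      have "walk_length d xs = walk_length (circle w) xs"
        using walk_length_cong[OF xs(2)] edge by blast
      then show "circle w x y \<le> l"
        using dist_le_walk_length[OF pm, of xs] xs by (auto simp: walk_def)
    qed
  qed
qed

lemma general_path_distance_scale:
  assumes d: "general_path_distance V p d" "general_path_distance V p d'" and c: "c > 0"
    and edges: "\<And>i. i < n \<Longrightarrow> d' i (nx i) = c * d i (nx i)" and xy: "x < n" "y < n"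
  shows "d' x y = c * d x y"
proof -
  have pos: "pos (\<lambda>i. d' i (nx i)) u = c * pos (\<lambda>i. d i (nx i)) u" if "u < n" for u
    using edges that by (simp add: pos_def sum_distrib_left)
  have tot: "total (\<lambda>i. d' i (nx i)) = c * total (\<lambda>i. d i (nx i))"
    using edges by (simp add: sum_distrib_left)
  have "circle (\<lambda>i. d' i (nx i)) x y = c * circle (\<lambda>i. d i (nx i)) x y"
    unfolding circle_def pos[OF xy(1)] pos[OF xy(2)] tot using c
    by (simp add: min_mult_distrib_left abs_mult right_diff_distrib flip: right_diff_distrib)
  then show ?thesis
    using general_path_distance_eq_circle(3)[OF d(1) xy] general_path_distance_eq_circle(3)[OF d(2) xy]
    by simp
qed


section \<open>The transport operator on edge lengths\<close>

text \<open>Both plans have to grow. \<open>Q\<close> lifts the second, where it has positive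
  weight, but is absent from the first; \<open>S\<close> or \<open>T\<close> lifts the first, while
  its weight in the second may be 0.\<close>

lemma cost_strict_mono:
  assumes i: "i < n" and le: "y \<le> y'" "S \<le> S'" "T \<le> T'" and Q: "Q < Q'" and ST: "S < S' \<or> T < T'"
  shows "cost i y S T Q < cost i y' S' T' Q'"
proof -
  define \<beta> \<alpha> m where "\<beta> = bwd i" and "\<alpha> = 1 - bwd (nx i)" and "m = min \<alpha> \<beta>"
  have pos: "\<beta> > 0" "\<alpha> > 0" "m > 0" "\<beta> - m \<ge> 0" "\<alpha> - m \<ge> 0"
    using weights[OF i] by (simp_all add: \<alpha>_def \<beta>_def m_def)
  have "\<beta> * S + \<alpha> * T < \<beta> * S' + \<alpha> * T'"
    using ST
  proof
    assume "S < S'"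
    then show ?thesis using pos le by (intro add_less_le_mono mult_strict_left_mono mult_left_mono) auto
  next
    assume "T < T'"
    then show ?thesis using pos le by (intro add_le_less_mono mult_strict_left_mono mult_left_mono) auto
  qed
  moreover have "m * y + (\<beta> - m) * S + (\<alpha> - m) * T + m * Q < m * y' + (\<beta> - m) * S' + (\<alpha> - m) * T' + m * Q'"
    using pos le Q by (intro add_le_less_mono add_mono mult_strict_left_mono mult_left_mono) auto
  ultimately show ?thesis
    unfolding cost_def Let_def \<alpha>_def[symmetric] \<beta>_def[symmetric] m_def[symmetric] by linarith
qed

lemma cost_scale:
  assumes "c \<ge> 0"
  shows "cost i (c * y) (c * S) (c * T) (c * Q) = c * cost i y S T Q"
proof -
  have "c * min a b = min (c * a) (c * b)" for a b
    using assms by (simp add: min_mult_distrib_left)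
  moreover define \<beta> \<alpha> m where "\<beta> = bwd i" and "\<alpha> = 1 - bwd (nx i)" and "m = min \<alpha> \<beta>"
  ultimately show ?thesis
    unfolding cost_def Let_def \<alpha>_def[symmetric] \<beta>_def[symmetric] m_def[symmetric]
    by (simp only: distrib_left mult.left_commute[of c])
qed

text \<open>The operator \<open>T\<close> of the overview. Spelled out in edge lengths rather than
  through \<open>circle w\<close>, it is monotone on all vectors, also where the polygon inequality
  fails.\<close>

definition step :: "(nat \<Rightarrow> real) \<Rightarrow> nat \<Rightarrow> real" where
  "step w i = cost i (w i) (min (w (pv i) + w i) (total w - (w (pv i) + w i)))
     (min (w i + w (nx i)) (total w - (w i + w (nx i))))
     (min (w (pv i) + w i + w (nx i)) (total w - (w (pv i) + w i + w (nx i))))"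

lemma W1_circle:
  assumes "admissible w" "i < n"
  shows "W1 (circle w) i = step w i"
proof -
  have "\<And>k. k < n \<Longrightarrow> w k \<ge> 0" using assms(1) by (simp add: admissible_def)
  then show ?thesis
    using circle_window[of w i] circle_nx_admissible[OF assms] assms(2) by (simp add: W1_def step_def)
qed

text \<open>Splitting \<open>total w\<close> at the window turns every complementary arc into a sum
  of edge lengths, so all arguments of \<open>cost\<close> are visibly monotone.\<close>

lemma step_mono:
  assumes i: "i < n" and le: "\<And>k. k < n \<Longrightarrow> w k \<le> w' k"
  shows "step w i \<le> step w' i"
proof -
  have "(\<Sum>k\<in>V - {pv i, i, nx i}. w k) \<le> (\<Sum>k\<in>V - {pv i, i, nx i}. w' k)"
    using le by (intro sum_mono) auto
  then show ?thesis
    unfolding step_def sum_window[OF i, of w] sum_window[OF i, of w']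
    using le[of i] le[of "pv i"] le[of "nx i"] i by (intro cost_mono min.mono) auto
qed

text \<open>Growth at a neighbouring edge together with growth outside the window lengthens both
  arcs of the outer pair and both arcs of one pair two edges apart. Growth on one side only can be
  hidden by the minimum over the two arcs.\<close>

lemma step_strict_mono:
  assumes i: "i < n" and le: "\<And>k. k < n \<Longrightarrow> w k \<le> w' k"
    and near: "w (pv i) < w' (pv i) \<or> w (nx i) < w' (nx i)"
    and far: "k < n" "k \<noteq> pv i" "k \<noteq> i" "k \<noteq> nx i" "w k < w' k"
  shows "step w i < step w' i"
proof -
  have "(\<Sum>k\<in>V - {pv i, i, nx i}. w k) < (\<Sum>k\<in>V - {pv i, i, nx i}. w' k)"
    using le far by (intro sum_strict_mono_ex1) auto
  then show ?thesis
    unfolding step_def sum_window[OF i, of w] sum_window[OF i, of w']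
    using le[of i] le[of "pv i"] le[of "nx i"] i near by (intro cost_strict_mono) (auto simp: min_def)
qed

lemma step_scale:
  assumes "c \<ge> 0"
  shows "step (\<lambda>k. c * w k) i = c * step w i"
proof -
  have "min (c * a) (c * b) = c * min a b" for a b
    using assms by (simp add: min_mult_distrib_left)
  then show ?thesis
    unfolding step_def sum_distrib_left[symmetric] distrib_left[symmetric] right_diff_distrib[symmetric]
    by (simp only: cost_scale[OF assms])
qed

text \<open>Handles a change in a single coordinate, which \<open>step_strict_mono\<close> does not
  see. Scale \<open>w\<close> by \<open>w' i\<close> and \<open>w'\<close> by \<open>w i\<close>:
  coordinate \<open>i\<close> now agrees, while every other edge is strictly longer in the scaled
  \<open>w\<close>.\<close>

lemma step_strict_sublinear:
  assumes i: "i < n" and pos: "\<And>k. k < n \<Longrightarrow> w k > 0"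
    and eq: "\<And>k. k < n \<Longrightarrow> k \<noteq> i \<Longrightarrow> w' k = w k" and less: "w i < w' i"
  shows "w i * step w' i < w' i * step w i"
proof -
  define x y z y' r where "x = w (pv i)" and "y = w i" and "z = w (nx i)" and "y' = w' i"
    and "r = (\<Sum>k\<in>V - {pv i, i, nx i}. w k)"
  note D = nx_pv_distinct[OF i]
  have w': "w' (pv i) = x" "w' (nx i) = z" using eq i D by (simp_all add: x_def z_def)
  have r': "(\<Sum>k\<in>V - {pv i, i, nx i}. w' k) = r" unfolding r_def using eq by (intro sum.cong) auto
  \<comment> \<open>The part outside the window is nonempty, so the complementary arc of the outer
    pair grows strictly under the scaling as well.\<close>
  have "nx (nx i) \<in> V - {pv i, i, nx i}" using i D by auto
  then have "r > 0" unfolding r_def using pos by (intro sum_pos) auto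
  moreover have "x > 0" "y > 0" "z > 0" using pos i by (simp_all add: x_def y_def z_def)
  ultimately have p: "x > 0" "y > 0" "z > 0" "r > 0" "y < y'" "y' > 0"
    using less by (simp_all add: y_def y'_def)
  then have q: "y * x < y' * x" "y * z < y' * z" "y * r < y' * r" by simp_all
  have minmul: "min (c * a) (c * b) = c * min a b" if "c \<ge> 0" for a b c :: real
    using that by (simp add: min_mult_distrib_left)
  have tot: "total w = x + y + z + r" "total w' = x + y' + z + r"
    using sum_window[OF i, of w] sum_window[OF i, of w'] r' w'
    by (simp_all add: x_def y_def z_def y'_def r_def)
  have "y * cost i y' (min (x + y') (z + r)) (min (y' + z) (x + r)) (min (x + y' + z) r)
     = cost i (y * y') (min (y * x + y * y') (y * z + y * r)) (min (y * y' + y * z) (y * x + y * r))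
      (min (y * x + y * y' + y * z) (y * r))"
    unfolding distrib_left[symmetric] minmul[OF less_imp_le[OF p(2)]]
    by (rule cost_scale[symmetric]) (use p in simp)
  also have "\<dots> < cost i (y * y') (min (y' * x + y * y') (y' * z + y' * r))
      (min (y * y' + y' * z) (y' * x + y' * r)) (min (y' * x + y * y' + y' * z) (y' * r))"
    using q by (intro cost_strict_mono i) (auto simp: min_def)
  also have "\<dots> = y' * cost i y (min (x + y) (z + r)) (min (y + z) (x + r)) (min (x + y + z) r)"
    unfolding mult.commute[of y y'] distrib_left[symmetric] minmul[OF less_imp_le[OF p(6)]]
    by (rule cost_scale) (use p in simp)
  finally show ?thesis
    unfolding step_def tot w' x_def[symmetric] y_def[symmetric] z_def[symmetric] y'_def[symmetric]
    by (simp add: algebra_simps)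
qed

lemma step_le:
  assumes "i < n"
  shows "step w i \<le> bwd i * (w (pv i) + w i) + (1 - bwd (nx i)) * (w i + w (nx i))"
proof -
  have "step w i \<le> bwd i * min (w (pv i) + w i) (total w - (w (pv i) + w i)) +
      (1 - bwd (nx i)) * min (w i + w (nx i)) (total w - (w i + w (nx i)))"
    unfolding step_def cost_def Let_def by linarith
  also have "\<dots> \<le> bwd i * (w (pv i) + w i) + (1 - bwd (nx i)) * (w i + w (nx i))"
    using weights(1,2)[OF assms] by (intro add_mono mult_left_mono) auto
  finally show ?thesis .
qed

text \<open>Shifting the index pairs \<open>bwd (nx i)\<close> with \<open>1 - bwd (nx i)\<close>,
  so each pair of consecutive edges is counted with weight 1.\<close>

lemma sum_step_bound:
  "(\<Sum>i\<in>V. bwd i * (w (pv i) + w i) + (1 - bwd (nx i)) * (w i + w (nx i))) = 2 * total w"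
proof -
  have "(\<Sum>i\<in>V. bwd i * (w (pv i) + w i)) = (\<Sum>i\<in>V. bwd (nx i) * (w (pv (nx i)) + w (nx i)))"
    by (rule sum_nx[symmetric])
  also have "\<dots> = (\<Sum>i\<in>V. bwd (nx i) * (w i + w (nx i)))" by (rule sum.cong) auto
  finally have "(\<Sum>i\<in>V. bwd i * (w (pv i) + w i) + (1 - bwd (nx i)) * (w i + w (nx i))) =
      (\<Sum>i\<in>V. bwd (nx i) * (w i + w (nx i)) + (1 - bwd (nx i)) * (w i + w (nx i)))"
    by (simp add: sum.distrib)
  also have "\<dots> = (\<Sum>i\<in>V. w i + w (nx i))" by (simp add: algebra_simps)
  also have "\<dots> = 2 * total w" using sum_nx[of w] by (simp add: sum.distrib)
  finally show ?thesis .
qed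

lemma sum_step_le: "(\<Sum>i\<in>V. step w i) \<le> 2 * total w"
  unfolding sum_step_bound[symmetric] by (intro sum_mono step_le) auto

lemma step_admissible:
  assumes "admissible w"
  shows "admissible (step w)"
proof -
  have pm: "pseudometric (circle w)"
    using circle_pseudometric[of w] assms by (simp add: admissible_def)
  show ?thesis
    unfolding admissible_def
    using W1_nonneg[OF pm] W1_le_sum[OF pm] W1_circle[OF assms] by simp
qed

section \<open>Uniqueness of positive eigenvectors\<close>

lemma nx_closed_eq:
  assumes "S \<subseteq> V" "s \<in> S" and nx: "\<And>i. i \<in> S \<Longrightarrow> nx i \<in> S"
  shows "S = V"
proof -
  have up: "a + m < n \<Longrightarrow> a + m \<in> S" if "a \<in> S" for a m
  proof (induction m)
    case (Suc m)
    then show ?case using nx[of "a + m"] by (simp add: nx_def)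
  qed (use that in simp)
  have "s < n" using assms by auto
  then have "n - 1 \<in> S" using up[OF assms(2), of "n - 1 - s"] by simp
  then have "0 \<in> S" using nx[of "n - 1"] n5 by (simp add: nx_def)
  then show ?thesis using up[of 0] assms(1) by auto
qed

text \<open>A substitute for irreducibility. \<open>S\<close> will be the set where two comparable
  vectors differ; by \<open>step_strict_mono\<close>, their images can agree at a vertex outside
  \<open>S\<close> and next to it only if \<open>S\<close> lies within its two neighbours.\<close>

lemma singleton_if_locally_isolated:
  assumes S: "S \<subseteq> V" "S \<noteq> {}" "S \<noteq> V"
    and loc: "\<And>i. i < n \<Longrightarrow> i \<notin> S \<Longrightarrow> pv i \<in> S \<or> nx i \<in> S \<Longrightarrow> S \<subseteq> {pv i, nx i}"
  obtains j where "S = {j}"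
proof -
  obtain j where j: "j \<in> S" "nx j \<notin> S" using nx_closed_eq[of S] S by blast
  have jn: "j < n" using j S by auto
  have 1: "S \<subseteq> {j, nx (nx j)}" using loc[of "nx j"] j jn by auto
  \<comment> \<open>The vertices \<open>j - 2\<close> and \<open>j + 2\<close> differ modulo
    \<open>n\<close> because \<open>n \<ge> 5\<close>, so the two inclusions for \<open>S\<close>
    share only \<open>j\<close>.\<close>
  have D: "pv j \<noteq> j" "pv j \<noteq> nx (nx j)" "pv (pv j) \<noteq> nx (nx j)"
    using jn n5 by (auto simp: nx_def pv_def split: if_splits)
  then have "S \<subseteq> {pv (pv j), j}" using loc[of "pv j"] 1 j jn by auto
  then have "S = {j}" using 1 D j by auto
  then show thesis by (rule that)
qed

text \<open>The largest ratio \<open>v i / u i\<close> scales \<open>u\<close> so that it touches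
  \<open>v\<close> from above; at the contact vertex monotonicity compares the eigenvalues.\<close>

lemma eigenvalue_le:
  assumes u: "\<And>i. i < n \<Longrightarrow> u i > 0" "\<And>i. i < n \<Longrightarrow> step u i = l * u i"
    and v: "\<And>i. i < n \<Longrightarrow> v i > 0" "\<And>i. i < n \<Longrightarrow> step v i = l' * v i"
  obtains c where "c > 0" "\<And>i. i < n \<Longrightarrow> v i \<le> c * u i" "\<exists>i<n. v i = c * u i" "l' \<le> l"
proof -
  define c where "c = Max ((\<lambda>i. v i / u i) ` V)"
  have V: "V \<noteq> {}" using n5 by auto
  have "c \<in> (\<lambda>i. v i / u i) ` V" unfolding c_def using V by (intro Max_in) auto
  then obtain i where i: "i < n" "c = v i / u i" by auto
  have c: "c > 0" using i u v by simp
  have le: "v k \<le> c * u k" if "k < n" for k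
  proof -
    have "v k / u k \<le> c" unfolding c_def using that by (intro Max_ge) auto
    then show ?thesis using u(1)[OF that] by (simp add: divide_simps)
  qed
  have eq: "v i = c * u i" using i u(1)[of i] by simp
  have "step v i \<le> step (\<lambda>k. c * u k) i" using le i by (intro step_mono) auto
  also have "\<dots> = l * v i" using c u(2)[OF i(1)] eq by (simp add: step_scale)
  finally have "l' \<le> l" using v i by simp
  then show thesis using that c le eq i by blast
qed

text \<open>Comparing both ways equates the eigenvalues. Wherever \<open>v\<close> touches the
  scaled \<open>u\<close>, the images agree too, so the set \<open>S\<close> of strict inequality
  shrinks to at most one vertex by strict monotonicity, and \<open>step_strict_sublinear\<close>
  excludes that vertex.\<close>

lemma eigenvector_unique:
  assumes u: "\<And>i. i < n \<Longrightarrow> u i > 0" "\<And>i. i < n \<Longrightarrow> step u i = l * u i"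
    and v: "\<And>i. i < n \<Longrightarrow> v i > 0" "\<And>i. i < n \<Longrightarrow> step v i = l' * v i"
  obtains c where "c > 0" "\<And>i. i < n \<Longrightarrow> v i = c * u i"
proof -
  obtain c where c: "c > 0" "\<And>i. i < n \<Longrightarrow> v i \<le> c * u i" "\<exists>i<n. v i = c * u i" "l' \<le> l"
    using eigenvalue_le[of u l v l'] u v by blast
  have "l \<le> l'" using eigenvalue_le[of v l' u l] u v by blast
  then have l: "l' = l" using c by simp
  define u' where "u' = (\<lambda>k. c * u k)"
  have u': "step u' i = l * u' i" if "i < n" for i
    using c u(2)[OF that] by (simp add: u'_def step_scale)
  define S where "S = {k. k < n \<and> v k < u' k}"
  have "S = {}"
  proof (rule ccontr)
    assume "S \<noteq> {}"
    moreover obtain e where "e < n" "e \<notin> S" using c(3) unfolding S_def u'_def by force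
    then have "S \<noteq> V" by auto
    moreover have "S \<subseteq> V" by (auto simp: S_def)
    moreover have "S \<subseteq> {pv i, nx i}" if i: "i < n" "i \<notin> S" "pv i \<in> S \<or> nx i \<in> S" for i
    proof (rule ccontr)
      assume "\<not> S \<subseteq> {pv i, nx i}"
      then obtain k where k: "k \<in> S" "k \<noteq> pv i" "k \<noteq> nx i" by blast
      have "v i = u' i" using i c(2)[of i] by (auto simp: S_def u'_def)
      then have "step v i = step u' i" using u' v(2) l i by simp
      moreover have "step v i < step u' i"
        using i k c(2) by (intro step_strict_mono[of i v u' k]) (auto simp: S_def u'_def)
      ultimately show False by simp
    qed
    ultimately obtain j where j: "S = {j}" using singleton_if_locally_isolated[of S] by blast
    then have jn: "j < n" "v j < u' j" by (auto simp: S_def)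
    have "u' k = v k" if "k < n" "k \<noteq> j" for k
      using that j c(2)[of k] by (force simp: S_def u'_def)
    then have "v j * step u' j < u' j * step v j"
      using jn v(1) by (intro step_strict_sublinear) auto
    then show False using u' v(2) l jn by simp
  qed
  then have "v i = c * u i" if "i < n" for i
    using that c(2)[of i] by (force simp: S_def u'_def)
  then show thesis using that c by blast
qed


section \<open>Existence of a positive eigenvector\<close>

text \<open>Admissible vectors of total 1, for which the polygon inequality is the cap
  \<open>1 / 2\<close>. Coordinates from \<open>n\<close> on are pinned to 0 to make the set compact
  in the function space.\<close>

definition capped_simplex :: "(nat \<Rightarrow> real) set" where
  "capped_simplex = {w. (\<forall>i<n. 0 \<le> w i \<and> w i \<le> 1 / 2) \<and> (\<forall>i\<ge>n. w i = 0) \<and> total w = 1}"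

lemma capped_simplex_admissible: "w \<in> capped_simplex \<Longrightarrow> admissible w"
  by (auto simp: capped_simplex_def admissible_def)

lemma continuous_on_snd_coord: "continuous_on S (\<lambda>z. snd z i)"
  for S :: "(real \<times> (nat \<Rightarrow> real)) set"
  by (rule continuous_on_product_then_coordinatewise) (rule continuous_on_snd[OF continuous_on_id])

lemma continuous_on_step: "continuous_on S (\<lambda>z. step (snd z) i)"
  for S :: "(real \<times> (nat \<Rightarrow> real)) set"
  unfolding step_def cost_def Let_def by (intro continuous_intros continuous_on_snd_coord)

text \<open>Tychonoff's theorem for the box \<open>?B\<close>, cut with a closed hyperplane.\<close>

lemma compact_capped_simplex: "compact capped_simplex"
proof -
  let ?B = "PiE UNIV (\<lambda>i. if i < n then {0..1/2} else {0}) :: (nat \<Rightarrow> real) set"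
  have "compactin (product_topology (\<lambda>i. euclidean) UNIV) ?B"
    by (subst compactin_PiE) auto
  then have "compact ?B" by (simp add: euclidean_product_topology)
  moreover have "closed {w :: nat \<Rightarrow> real. total w = 1}"
    by (intro closed_Collect_eq continuous_on_sum continuous_on_product_coordinates continuous_on_const)
  moreover have "capped_simplex = ?B \<inter> {w. total w = 1}"
    by (auto simp: capped_simplex_def PiE_iff split: if_splits)
  ultimately show ?thesis by (simp add: compact_Int_closed)
qed

lemma uniform_in_capped_simplex: "(\<lambda>i. if i < n then 1 / real n else 0) \<in> capped_simplex"
  using n5 by (auto simp: capped_simplex_def divide_simps)

lemma normalize_in_capped_simplex:
  assumes "admissible u" "total u > 0"
  shows "(\<lambda>i. if i < n then u i / total u else 0) \<in> capped_simplex"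
proof -
  have "(\<Sum>k\<in>V. if k < n then u k / total u else 0) = (\<Sum>k\<in>V. u k / total u)"
    by (rule sum.cong) auto
  also have "\<dots> = 1" using assms(2) by (simp flip: sum_divide_distrib)
  finally show ?thesis
    using assms by (auto simp: capped_simplex_def admissible_def divide_simps)
qed

text \<open>Perturbing by \<open>\<epsilon> * total w\<close> makes the operator strongly monotone, so that a maximiser of
  the Collatz-Wielandt quotient is an eigenvector.\<close>

lemma perturbed_eigenvector:
  fixes e :: real
  assumes e: "e > 0"
  obtains l w where "0 \<le> l" "l \<le> 2 + n * e" "w \<in> capped_simplex" "\<And>i. i < n \<Longrightarrow> step w i + e = l * w i"
proof -
  define B where "B = 2 + n * e"
  \<comment> \<open>The largest \<open>l\<close> occurring in \<open>A\<close> is sought. On the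
    simplex \<open>total w = 1\<close>, so \<open>e\<close> stands for
    \<open>e * total w\<close>.\<close>
  define A where "A = ({0..B} \<times> capped_simplex) \<inter> (\<Inter>i\<in>V. {z. fst z * snd z i \<le> step (snd z) i + e})"
  have "closed {z :: real \<times> (nat \<Rightarrow> real). fst z * snd z i \<le> step (snd z) i + e}" for i
    by (intro closed_Collect_le continuous_intros continuous_on_snd_coord continuous_on_step)
  then have "compact A"
    unfolding A_def by (intro compact_Int_closed compact_Times compact_capped_simplex closed_INT) auto
  have nonneg: "step w i \<ge> 0" if "w \<in> capped_simplex" "i < n" for w i
    using step_admissible[OF capped_simplex_admissible[OF that(1)]] that(2) by (simp add: admissible_def)
  \<comment> \<open>The cap \<open>B\<close> on \<open>l\<close> excludes nothing: sum the
    inequalities over all vertices.\<close>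
  have bound: "l \<le> B" if w: "w \<in> capped_simplex" and le: "\<And>i. i < n \<Longrightarrow> l * w i \<le> step w i + e" for l w
  proof -
    have "l * total w \<le> (\<Sum>i\<in>V. step w i + e)"
      unfolding sum_distrib_left using le by (intro sum_mono) auto
    also have "\<dots> \<le> 2 * total w + n * e" using sum_step_le[of w] by (simp add: sum.distrib)
    finally show ?thesis using w by (simp add: capped_simplex_def B_def)
  qed
  have "(0, \<lambda>i. if i < n then 1 / real n else 0) \<in> A"
    using uniform_in_capped_simplex nonneg[OF uniform_in_capped_simplex] e
    by (auto simp: A_def B_def less_imp_le intro!: add_nonneg_nonneg)
  then have "A \<noteq> {}" by blast
  have "continuous_on A fst" by (intro continuous_on_fst continuous_on_id)
  then obtain z where z: "z \<in> A" and max: "\<And>z'. z' \<in> A \<Longrightarrow> fst z' \<le> fst z"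
    using continuous_attains_sup[OF \<open>compact A\<close> \<open>A \<noteq> {}\<close>, of fst] by blast
  obtain l w where lw: "z = (l, w)" by (cases z)
  have l: "0 \<le> l" "l \<le> B" and w: "w \<in> capped_simplex" and le: "\<And>i. i < n \<Longrightarrow> l * w i \<le> step w i + e"
    using z by (auto simp: A_def lw)
  have tot: "total w = 1" using w by (simp add: capped_simplex_def)
  have "step w i + e = l * w i" if i: "i < n" for i
  proof (rule ccontr)
    assume "step w i + e \<noteq> l * w i"
    then have less: "l * w i < step w i + e" using le[OF i] by simp
    \<comment> \<open>One application of the perturbed operator to \<open>w\<close>: through the
      term \<open>e * total u\<close> the strict inequality at \<open>i\<close> spreads to every
      coordinate.\<close>
    define u where "u = (\<lambda>k. step w k + e)"
    have adm: "admissible u"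
    proof -
      have "2 * step w k \<le> (\<Sum>k\<in>V. step w k)" if "k < n" for k
        using step_admissible[OF capped_simplex_admissible[OF w]] that by (simp add: admissible_def)
      moreover have "2 * e \<le> n * e" using n5 e by simp
      moreover have "total u = (\<Sum>k\<in>V. step w k) + n * e" by (simp add: u_def sum.distrib)
      ultimately show ?thesis
        unfolding admissible_def using nonneg[OF w] e by (simp add: u_def add_mono)
    qed
    have upos: "u k > 0" if "k < n" for k using nonneg[OF w that] e by (simp add: u_def)
    then have Upos: "total u > 0" using n5 by (intro sum_pos) auto
    have strict: "l * u k < step u k + e * total u" if k: "k < n" for k
    proof -
      have "l * step w k = step (\<lambda>j. l * w j) k" using l by (simp add: step_scale)
      also have "\<dots> \<le> step u k" using le k by (intro step_mono) (auto simp: u_def)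
      finally have "l * step w k \<le> step u k" .
      moreover have "(\<Sum>j\<in>V. l * w j) < total u"
        using le less i by (intro sum_strict_mono_ex1) (auto simp: u_def)
      then have "l < total u" using tot by (simp flip: sum_distrib_left)
      then have "l * e < total u * e" using e by simp
      ultimately show ?thesis by (simp add: u_def algebra_simps)
    qed
    \<comment> \<open>The least quotient for \<open>u\<close> exceeds \<open>l\<close>; normalising
      \<open>u\<close> then contradicts maximality.\<close>
    define l' where "l' = Min ((\<lambda>k. (step u k + e * total u) / u k) ` V)"
    have "l' \<in> (\<lambda>k. (step u k + e * total u) / u k) ` V"
      unfolding l'_def using n5 by (intro Min_in) auto
    then obtain j where j: "j < n" "l' = (step u j + e * total u) / u j" by auto
    have "l < l'" using strict[OF j(1)] upos[OF j(1)] by (simp add: j divide_simps)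
    have l'le: "l' * u k \<le> step u k + e * total u" if "k < n" for k
    proof -
      have "l' \<le> (step u k + e * total u) / u k"
        unfolding l'_def using that by (intro Min_le) auto
      then show ?thesis using upos[OF that] by (simp add: divide_simps)
    qed
    define v where "v = (\<lambda>i. if i < n then u i / total u else 0)"
    have v: "v \<in> capped_simplex" unfolding v_def by (rule normalize_in_capped_simplex[OF adm Upos])
    have v_le: "l' * v k \<le> step v k + e" if k: "k < n" for k
    proof -
      \<comment> \<open>\<open>v\<close> and the scaled \<open>u\<close> may differ beyond
        \<open>n\<close>; monotonicity in both directions shows that \<open>step\<close> does not
        notice.\<close>
      have "step v k = step (\<lambda>i. inverse (total u) * u i) k"
      proof (rule antisym)
        show "step v k \<le> step (\<lambda>i. inverse (total u) * u i) k"
          using k by (intro step_mono) (auto simp: v_def divide_simps)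
        show "step (\<lambda>i. inverse (total u) * u i) k \<le> step v k"
          using k by (intro step_mono) (auto simp: v_def divide_simps)
      qed
      also have "\<dots> = step u k / total u" using Upos by (simp add: step_scale divide_inverse)
      finally show ?thesis
        using l'le[OF k] Upos k by (simp add: v_def divide_simps algebra_simps)
    qed
    have "(l', v) \<in> A"
      using v v_le bound[OF v v_le] \<open>l < l'\<close> l by (auto simp: A_def)
    then show False using max[of "(l', v)"] \<open>l < l'\<close> by (simp add: lw)
  qed
  then show thesis using that[of l w] l w by (simp add: B_def)
qed

text \<open>The residual \<open>g\<close> attains its minimum on a compact set, and the perturbed
  eigenvectors make it arbitrarily small, so the minimum is 0. This replaces the extraction of a
  convergent subsequence.\<close>

lemma step_eigenvector_exists:
  obtains l w where "w \<in> capped_simplex" "\<And>i. i < n \<Longrightarrow> step w i = l * w i"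
proof -
  define A where "A = {0..2 + real n} \<times> capped_simplex"
  define g where "g z = (\<Sum>i\<in>V. \<bar>step (snd z) i - fst z * snd z i\<bar>)" for z :: "real \<times> (nat \<Rightarrow> real)"
  have "compact A" unfolding A_def by (intro compact_Times compact_capped_simplex) auto
  moreover have "A \<noteq> {}" using uniform_in_capped_simplex by (auto simp: A_def)
  moreover have "continuous_on A g"
    unfolding g_def by (intro continuous_intros continuous_on_snd_coord continuous_on_step)
  ultimately obtain z where z: "z \<in> A" and min: "\<And>z'. z' \<in> A \<Longrightarrow> g z \<le> g z'"
    using continuous_attains_inf[of A g] by blast
  have "g z \<le> 0 + e" if "e > 0" for e
  proof -
    \<comment> \<open>\<open>e' \<le> 1\<close> keeps the eigenvalue in the range of
      \<open>A\<close>, and \<open>n * e'\<close> is the residual of the perturbed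
      eigenvector.\<close>
    define e' where "e' = min 1 (e / n)"
    have e': "e' > 0" "e' \<le> 1" "n * e' \<le> e"
      using that n5 by (auto simp: e'_def min_def divide_simps mult.commute)
    obtain l w where lw: "0 \<le> l" "l \<le> 2 + n * e'" "w \<in> capped_simplex" "\<And>i. i < n \<Longrightarrow> step w i + e' = l * w i"
      using perturbed_eigenvector[OF e'(1)] by blast
    have "n * e' \<le> n" using e' by (simp add: mult_left_le)
    then have "(l, w) \<in> A" using lw by (simp add: A_def)
    then have "g z \<le> g (l, w)" by (rule min)
    also have "\<dots> = (\<Sum>i\<in>V. e')"
      unfolding g_def using e'(1) by (intro sum.cong) (auto simp flip: lw(4))
    finally show ?thesis using e' by simp
  qed
  then have "g z \<le> 0" by (rule field_le_epsilon)
  moreover have "g z \<ge> 0" unfolding g_def by (intro sum_nonneg) auto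
  ultimately have "g z = 0" by simp
  then have "\<forall>i\<in>V. \<bar>step (snd z) i - fst z * snd z i\<bar> = 0"
    unfolding g_def by (subst (asm) sum_nonneg_eq_0_iff) auto
  then show thesis using that[of "snd z" "fst z"] z by (auto simp: A_def)
qed

text \<open>Strict monotonicity against the zero vector shows that the support is everything or a
  single vertex. In the latter case that coordinate would be 1, against the cap
  \<open>1 / 2\<close>.\<close>

lemma positive_eigenvector_exists:
  obtains l w where "admissible w" "\<And>i. i < n \<Longrightarrow> w i > 0" "\<And>i. i < n \<Longrightarrow> step w i = l * w i"
proof -
  obtain l w where w: "w \<in> capped_simplex" and eig: "\<And>i. i < n \<Longrightarrow> step w i = l * w i"
    using step_eigenvector_exists by blast
  have nonneg: "w i \<ge> 0" if "i < n" for i using w that by (simp add: capped_simplex_def)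
  define S where "S = {i. i < n \<and> w i > 0}"
  have zero: "w i = 0" if "i < n" "i \<notin> S" for i using that nonneg[of i] by (auto simp: S_def)
  have tot: "total w = 1" using w by (simp add: capped_simplex_def)
  have "S \<noteq> {}"
  proof
    assume "S = {}"
    then have "total w = 0" using zero by (intro sum.neutral) auto
    then show False using tot by simp
  qed
  have "S = V"
  proof (rule ccontr)
    assume "S \<noteq> V"
    moreover have "S \<subseteq> V" by (auto simp: S_def)
    moreover have "S \<subseteq> {pv i, nx i}" if i: "i < n" "i \<notin> S" "pv i \<in> S \<or> nx i \<in> S" for i
    proof (rule ccontr)
      assume "\<not> S \<subseteq> {pv i, nx i}"
      then obtain k where k: "k \<in> S" "k \<noteq> pv i" "k \<noteq> nx i" by blast
      \<comment> \<open>The zero vector, written as a multiple of \<open>w\<close> so that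
        \<open>step_scale\<close> evaluates it.\<close>
      have "step (\<lambda>k. 0 * w k) i < step w i"
        using i k nonneg by (intro step_strict_mono[of i _ w k]) (auto simp: S_def)
      then have "0 < step w i" using step_scale[of 0 w i] by simp
      then show False using eig zero i by simp
    qed
    ultimately obtain j where j: "S = {j}"
      using singleton_if_locally_isolated[of S] \<open>S \<noteq> {}\<close> by blast
    then have jn: "j < n" by (auto simp: S_def)
    have "total w = (\<Sum>k\<in>{j}. w k)"
      using jn j zero by (intro sum.mono_neutral_right) auto
    then show False using tot w jn by (auto simp: capped_simplex_def)
  qed
  then have "i \<in> S" if "i < n" for i using that by simp
  then have "\<And>i. i < n \<Longrightarrow> w i > 0" by (simp add: S_def)
  then show thesis using that capped_simplex_admissible[OF w] eig by blast
qed


section \<open>Constant curvature\<close>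

lemma W1_general_path_distance:
  assumes d: "general_path_distance V p d" and i: "i < n"
  shows "W1 d i = step (\<lambda>i. d i (nx i)) i"
proof -
  note w = general_path_distance_eq_circle[OF d]
  have "W1 d i = W1 (circle (\<lambda>i. d i (nx i))) i"
    unfolding W1_def using i by (simp add: w(3)[symmetric])
  then show ?thesis using W1_circle[OF w(2) i] by simp
qed

lemma pseudometric_general_path_distance:
  assumes d: "general_path_distance V p d"
  shows "pseudometric d"
proof -
  note w = general_path_distance_eq_circle[OF d]
  have "pseudometric (circle (\<lambda>i. d i (nx i)))"
    using circle_pseudometric w(1) by (simp add: less_imp_le)
  then show ?thesis
    unfolding pseudometric_def by (simp add: w(3)[symmetric])
qed

lemma curvature_general_path_distance:
  assumes d: "general_path_distance V p d" and i: "i < n"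
  shows "ollivier_curvature V p d i (nx i) = 2 - step (\<lambda>i. d i (nx i)) i / d i (nx i)"
proof -
  have "d x y > 0" if "x < n" "y < n" "x \<noteq> y" for x y
    unfolding general_path_distance_eq_circle(3)[OF d that(1,2)]
    by (rule circle_pos[OF general_path_distance_eq_circle(1)[OF d] that])
  then show ?thesis
    using ollivier_curvature_eq[OF pseudometric_general_path_distance[OF d] _ i]
      W1_general_path_distance[OF d i] by simp
qed

text \<open>Symmetry of the curvature leaves only the forward orientation to check; the parameter
  \<open>P\<close> serves equality with a constant as well as nonnegativity.\<close>

lemma curvature_all_edges:
  assumes d: "general_path_distance V p d"
  shows "(\<forall>x y. adj V p x y \<longrightarrow> P (ollivier_curvature V p d x y)) \<longleftrightarrow>
    (\<forall>i<n. P (ollivier_curvature V p d i (nx i)))"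
proof
  assume "\<forall>x y. adj V p x y \<longrightarrow> P (ollivier_curvature V p d x y)"
  then show "\<forall>i<n. P (ollivier_curvature V p d i (nx i))" by (simp add: adj_iff)
next
  assume P: "\<forall>i<n. P (ollivier_curvature V p d i (nx i))"
  show "\<forall>x y. adj V p x y \<longrightarrow> P (ollivier_curvature V p d x y)"
  proof (intro allI impI)
    fix x y assume "adj V p x y"
    then have x: "x < n" and "y = nx x \<or> y = pv x" by (auto simp: adj_iff)
    then show "P (ollivier_curvature V p d x y)"
    proof (elim disjE)
      assume y: "y = pv x"
      have "d x y = d y x"
        using pseudometric_general_path_distance[OF d] x y unfolding pseudometric_def
        by (metis atLeastLessThan_iff pv_less zero_le)
      then have "ollivier_curvature V p d x y = ollivier_curvature V p d y (nx y)"
        using ollivier_curvature_sym[of d x y] x y by simp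
      moreover have "P (ollivier_curvature V p d y (nx y))" using P[rule_format, of y] x y by simp
      ultimately show ?thesis by (simp only:)
    qed (use P in simp)
  qed
qed

lemma constant_curvature_iff:
  assumes d: "general_path_distance V p d"
  shows "constant_curvature V p d \<longleftrightarrow> (\<exists>K. \<forall>i<n. ollivier_curvature V p d i (nx i) = K)"
  unfolding constant_curvature_def
  by (rule iff_exI) (rule curvature_all_edges[OF d, where P = "\<lambda>k. k = K" for K])

lemma constant_curvature_eigen:
  assumes d: "general_path_distance V p d" and i: "i < n"
  shows "ollivier_curvature V p d i (nx i) = K \<longleftrightarrow> step (\<lambda>i. d i (nx i)) i = (2 - K) * d i (nx i)"
proof -
  have "2 - s / y = K \<longleftrightarrow> s = (2 - K) * y" if "y > 0" for s y :: real
    using that by (auto simp: field_simps)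
  then show ?thesis
    unfolding curvature_general_path_distance[OF d i]
    using general_path_distance_eq_circle(1)[OF d i] by blast
qed

lemma constant_curvature_exists: "\<exists>d. general_path_distance V p d \<and> constant_curvature V p d"
proof -
  obtain l w where w: "admissible w" "\<And>i. i < n \<Longrightarrow> w i > 0" "\<And>i. i < n \<Longrightarrow> step w i = l * w i"
    by (rule positive_eigenvector_exists) blast
  have d: "general_path_distance V p (circle w)"
    by (rule circle_general_path_distance[OF w(1,2)])
  have "ollivier_curvature V p (circle w) i (nx i) = 2 - l" if "i < n" for i
  proof -
    have "W1 (circle w) i = l * w i" using W1_circle[OF w(1) that] w(3)[OF that] by simp
    then show ?thesis
      using constant_curvature_eigen[OF d that] W1_general_path_distance[OF d that]
        circle_nx_admissible[OF w(1) that] by simp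
  qed
  then show ?thesis using d constant_curvature_iff[OF d] by blast
qed

lemma constant_curvature_unique:
  assumes d: "general_path_distance V p d" "constant_curvature V p d"
    and d': "general_path_distance V p d'" "constant_curvature V p d'"
  shows "\<exists>c>0. \<forall>x\<in>V. \<forall>y\<in>V. d' x y = c * d x y"
proof -
  obtain K K' where K: "\<forall>i<n. ollivier_curvature V p d i (nx i) = K"
      "\<forall>i<n. ollivier_curvature V p d' i (nx i) = K'"
    using constant_curvature_iff[OF d(1)] constant_curvature_iff[OF d'(1)] d(2) d'(2) by blast
  have "step (\<lambda>i. d i (nx i)) i = (2 - K) * d i (nx i)"
    "step (\<lambda>i. d' i (nx i)) i = (2 - K') * d' i (nx i)" if "i < n" for i
    using K that constant_curvature_eigen[OF d(1) that] constant_curvature_eigen[OF d'(1) that] by blast+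
  then obtain c where c: "c > 0" "\<And>i. i < n \<Longrightarrow> d' i (nx i) = c * d i (nx i)"
    using eigenvector_unique[of "\<lambda>i. d i (nx i)" "2 - K" "\<lambda>i. d' i (nx i)" "2 - K'"]
      general_path_distance_eq_circle(1)[OF d(1)] general_path_distance_eq_circle(1)[OF d'(1)] by blast
  then show ?thesis
    using general_path_distance_scale[OF d(1) d'(1) c] by auto
qed

text \<open>Equality case of \<open>step_le\<close>. If the window is at most half the cycle, every
  minimum is the direct arc and both plans give the bound. Otherwise \<open>Q\<close> is the other
  arc, and its positive weight makes the second plan strictly cheaper than the bound.\<close>

lemma step_eq_bound_iff:
  assumes i: "i < n" and w: "\<And>i. i < n \<Longrightarrow> w i > 0"
  shows "step w i = bwd i * (w (pv i) + w i) + (1 - bwd (nx i)) * (w i + w (nx i)) \<longleftrightarrow>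
    2 * (w (pv i) + w i + w (nx i)) \<le> total w"
proof -
  define \<beta> \<alpha> m where "\<beta> = bwd i" and "\<alpha> = 1 - bwd (nx i)" and "m = min \<alpha> \<beta>"
  define x y z L where "x = w (pv i)" and "y = w i" and "z = w (nx i)" and "L = total w"
  have pos: "x > 0" "y > 0" "z > 0" using w i by (simp_all add: x_def y_def z_def)
  have wt: "\<beta> > 0" "\<alpha> > 0" "m > 0" "\<beta> - m \<ge> 0" "\<alpha> - m \<ge> 0"
    using weights[OF i] by (simp_all add: \<alpha>_def \<beta>_def m_def)
  define S T Q where "S = min (x + y) (L - (x + y))" and "T = min (y + z) (L - (y + z))"
    and "Q = min (x + y + z) (L - (x + y + z))"
  have step: "step w i = min (\<beta> * S + \<alpha> * T) (m * y + (\<beta> - m) * S + (\<alpha> - m) * T + m * Q)"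
    unfolding step_def cost_def Let_def S_def T_def Q_def x_def y_def z_def L_def m_def \<alpha>_def \<beta>_def ..
  have "step w i = \<beta> * (x + y) + \<alpha> * (y + z)" if "2 * (x + y + z) \<le> L"
  proof -
    have "S = x + y" "T = y + z" "Q = x + y + z" using that pos by (auto simp: S_def T_def Q_def)
    then show ?thesis unfolding step by (simp add: algebra_simps)
  qed
  moreover have "step w i < \<beta> * (x + y) + \<alpha> * (y + z)" if "\<not> 2 * (x + y + z) \<le> L"
  proof -
    have "step w i \<le> m * y + (\<beta> - m) * S + (\<alpha> - m) * T + m * Q" unfolding step by simp
    also have "\<dots> < m * y + (\<beta> - m) * (x + y) + (\<alpha> - m) * (y + z) + m * (x + y + z)"
      using wt that by (intro add_le_less_mono add_mono mult_strict_left_mono mult_left_mono)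
        (auto simp: S_def T_def Q_def)
    also have "\<dots> = \<beta> * (x + y) + \<alpha> * (y + z)" by (simp add: algebra_simps)
    finally show ?thesis .
  qed
  ultimately show ?thesis
    unfolding \<alpha>_def \<beta>_def x_def y_def z_def L_def by fastforce
qed

text \<open>Sum the eigenvalue equation over the cycle: \<open>(2 - K) * total w\<close> is at most
  \<open>2 * total w\<close>, and equality of the sums forces equality at each edge.\<close>

lemma constant_curvature_sign:
  assumes d: "general_path_distance V p d" and K: "\<And>i. i < n \<Longrightarrow> ollivier_curvature V p d i (nx i) = K"
  defines "w \<equiv> \<lambda>i. d i (nx i)"
  shows "K \<ge> 0" "K = 0 \<longleftrightarrow> (\<forall>i<n. 2 * (w (pv i) + w i + w (nx i)) \<le> total w)"
proof -
  have w: "\<And>i. i < n \<Longrightarrow> w i > 0" using general_path_distance_eq_circle(1)[OF d] by (simp add: w_def)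
  have L: "total w > 0" using n5 w by (intro sum_pos) auto
  have eig: "step w i = (2 - K) * w i" if "i < n" for i
    unfolding w_def by (rule iffD1[OF constant_curvature_eigen[OF d that] K[OF that]])
  have sum: "(\<Sum>i\<in>V. step w i) = (2 - K) * total w"
    unfolding sum_distrib_left using eig by (intro sum.cong) auto
  then have "(2 - K) * total w \<le> 2 * total w" using sum_step_le[of w] by simp
  then show "K \<ge> 0" using L by simp
  let ?B = "\<lambda>i. bwd i * (w (pv i) + w i) + (1 - bwd (nx i)) * (w i + w (nx i))"
  have "K = 0 \<longleftrightarrow> (\<Sum>i\<in>V. step w i) = (\<Sum>i\<in>V. ?B i)"
    unfolding sum_step_bound sum using L by simp
  also have "\<dots> \<longleftrightarrow> (\<forall>i<n. step w i = ?B i)"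
  proof
    assume eq: "(\<Sum>i\<in>V. step w i) = (\<Sum>i\<in>V. ?B i)"
    show "\<forall>i<n. step w i = ?B i"
    proof (rule ccontr)
      assume "\<not> (\<forall>i<n. step w i = ?B i)"
      then obtain j where "j < n" "step w j < ?B j" using step_le[of _ w] by (meson le_less)
      then have "(\<Sum>i\<in>V. step w i) < (\<Sum>i\<in>V. ?B i)"
        using step_le[of _ w] by (intro sum_strict_mono_ex1) auto
      then show False using eq by simp
    qed
  next
    assume "\<forall>i<n. step w i = ?B i"
    then show "(\<Sum>i\<in>V. step w i) = (\<Sum>i\<in>V. ?B i)" by (intro sum.cong) auto
  qed
  also have "\<dots> \<longleftrightarrow> (\<forall>i<n. 2 * (w (pv i) + w i + w (nx i)) \<le> total w)"
    using step_eq_bound_iff[of _ w] w by simp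
  finally show "K = 0 \<longleftrightarrow> (\<forall>i<n. 2 * (w (pv i) + w i + w (nx i)) \<le> total w)" .
qed

end

section \<open>Quotients of dimension 0 and 1\<close>

lemma quotient_dim_eq_0:
  fixes U W :: "('b \<Rightarrow> real) set"
  assumes UW: "U \<subseteq> W" and zero: "(\<lambda>_. 0) \<in> U"
    and neg: "\<And>\<alpha>. \<alpha> \<in> W \<Longrightarrow> (\<lambda>e. - \<alpha> e) \<in> W"
  shows "quotient_dim U W = 0"
  unfolding quotient_dim_def
proof (rule the_equality)
  have "quotient_basis U W {}" using UW by (auto simp: quotient_basis_def)
  then show "\<exists>S. quotient_basis U W S \<and> card S = 0" by (intro exI[of _ "{}"]) simp
next
  fix k assume "\<exists>S. quotient_basis U W S \<and> card S = k"
  then obtain S where S: "quotient_basis U W S" "card S = k" by blast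
  have fin: "finite S" and SU: "S \<subseteq> U"
    and all: "\<forall>\<alpha>\<in>U. \<exists>!c. c \<in> S \<rightarrow>\<^sub>E UNIV \<and> (\<lambda>e. \<alpha> e - (\<Sum>s\<in>S. c s * s e)) \<in> W"
    using S(1) unfolding quotient_basis_def by - (elim conjE, assumption)+
  have ex1: "\<exists>!c. c \<in> S \<rightarrow>\<^sub>E UNIV \<and> (\<lambda>e. 0 - (\<Sum>s\<in>S. c s * s e)) \<in> W"
    by (rule bspec[OF all zero])
  have "S = {}"
  proof (rule ccontr)
    assume "S \<noteq> {}"
    then obtain t where t: "t \<in> S" by blast
    \<comment> \<open>Two distinct coefficient vectors for the zero coset: none, and a single basis
      element, which already lies in \<open>W\<close>.\<close>
    let ?c0 = "\<lambda>s\<in>S. 0::real" and ?c1 = "\<lambda>s\<in>S. if s = t then 1 else 0::real"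
    have "(\<Sum>s\<in>S. ?c0 s * s e) = 0" "(\<Sum>s\<in>S. ?c1 s * s e) = t e" for e
      using fin t by (simp_all add: if_distrib[of "\<lambda>c. c * _"] sum.delta cong: if_cong)
    then have "(\<lambda>e. 0 - (\<Sum>s\<in>S. ?c0 s * s e)) \<in> W" "(\<lambda>e. 0 - (\<Sum>s\<in>S. ?c1 s * s e)) \<in> W"
      using zero UW SU t neg[of t] by auto
    then have "?c0 = ?c1"
      by (intro trans[OF the1_equality[OF ex1, symmetric] the1_equality[OF ex1]] conjI) auto
    then have "?c0 t = ?c1 t" by (rule fun_cong)
    then show False using t by simp
  qed
  then show "k = 0" using S by simp
qed

text \<open>\<open>W\<close> is the kernel of the functional \<open>P\<close>, which identifies the
  quotient with the reals. Linearity is assumed in exactly the form in which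
  \<open>quotient_basis\<close> uses it.\<close>

lemma quotient_dim_eq_1:
  fixes U W :: "('b \<Rightarrow> real) set" and P :: "('b \<Rightarrow> real) \<Rightarrow> real"
  assumes W: "W = {\<alpha> \<in> U. P \<alpha> = 0}" and zero: "(\<lambda>_. 0) \<in> U" "P (\<lambda>_. 0) = 0"
    and comb: "\<And>\<alpha> c S. \<alpha> \<in> U \<Longrightarrow> S \<subseteq> U \<Longrightarrow> finite S \<Longrightarrow> (\<lambda>e. \<alpha> e - (\<Sum>s\<in>S. c s * s e)) \<in> U \<and>
      P (\<lambda>e. \<alpha> e - (\<Sum>s\<in>S. c s * s e)) = P \<alpha> - (\<Sum>s\<in>S. c s * P s)"
    and \<eta>: "\<eta> \<in> U" "P \<eta> \<noteq> 0"
  shows "quotient_dim U W = 1"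
proof -
  have basis: "quotient_basis U W S \<longleftrightarrow> finite S \<and> S \<subseteq> U \<and>
      (\<forall>\<alpha>\<in>U. \<exists>!c. c \<in> S \<rightarrow>\<^sub>E UNIV \<and> P \<alpha> = (\<Sum>s\<in>S. c s * P s))" for S
  proof -
    have "(\<lambda>e. \<alpha> e - (\<Sum>s\<in>S. c s * s e)) \<in> W \<longleftrightarrow> P \<alpha> = (\<Sum>s\<in>S. c s * P s)"
      if "\<alpha> \<in> U" "S \<subseteq> U" "finite S" for \<alpha> c
      using comb[OF that] by (simp add: W)
    then show ?thesis unfolding quotient_basis_def by (simp cong: conj_cong)
  qed
  show ?thesis
    unfolding quotient_dim_def
  proof (rule the_equality)
    have "\<exists>!c. c \<in> {\<eta>} \<rightarrow>\<^sub>E UNIV \<and> P \<alpha> = (\<Sum>s\<in>{\<eta>}. c s * P s)" for \<alpha>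
    proof (rule ex1I[of _ "\<lambda>s\<in>{\<eta>}. P \<alpha> / P \<eta>"])
      fix c assume c: "c \<in> {\<eta>} \<rightarrow>\<^sub>E UNIV \<and> P \<alpha> = (\<Sum>s\<in>{\<eta>}. c s * P s)"
      then have "c \<eta> = P \<alpha> / P \<eta>" using \<eta> by (simp add: divide_simps)
      then show "c = (\<lambda>s\<in>{\<eta>}. P \<alpha> / P \<eta>)"
        using c by (intro ext) (auto simp: PiE_def extensional_def restrict_def)
    qed (use \<eta> in auto)
    then have "quotient_basis U W {\<eta>}" unfolding basis using \<eta> by simp
    then show "\<exists>S. quotient_basis U W S \<and> card S = 1" by (intro exI[of _ "{\<eta>}"]) simp
  next
    fix k assume "\<exists>S. quotient_basis U W S \<and> card S = k"
    then obtain S where S: "quotient_basis U W S" "card S = k" by blast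
    have fin: "finite S" and ex: "\<exists>!c. c \<in> S \<rightarrow>\<^sub>E UNIV \<and> P \<alpha> = (\<Sum>s\<in>S. c s * P s)" if "\<alpha> \<in> U" for \<alpha>
      using S(1) that unfolding basis by blast+
    have "S \<noteq> {}" using ex[OF \<eta>(1)] \<eta>(2) by auto
    then obtain s where s: "s \<in> S" by blast
    have "S = {s}"
    proof (rule ccontr)
      assume "S \<noteq> {s}"
      then obtain t where t: "t \<in> S" "t \<noteq> s" using s by blast
      \<comment> \<open>A nontrivial linear relation between the numbers \<open>P s\<close> and
        \<open>P t\<close>; if both vanish, any coefficients do. It contradicts the uniqueness of
        coefficients for 0.\<close>
      define a b where "a = (if P s = 0 \<and> P t = 0 then 1 else P t)" and "b = (if P s = 0 \<and> P t = 0 then 1 else - P s)"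
      have ab: "a * P s + b * P t = 0" "a \<noteq> 0 \<or> b \<noteq> 0" by (auto simp: a_def b_def)
      let ?c0 = "\<lambda>r\<in>S. 0::real" and ?c1 = "\<lambda>r\<in>S. if r = s then a else if r = t then b else 0"
      have "(\<Sum>r\<in>S. ?c1 r * P r) = (\<Sum>r\<in>{s, t}. ?c1 r * P r)"
        using fin[OF zero(1)] s t by (intro sum.mono_neutral_right) auto
      also have "\<dots> = 0" using s t ab by simp
      finally have "P (\<lambda>_. 0) = (\<Sum>r\<in>S. ?c0 r * P r)" "P (\<lambda>_. 0) = (\<Sum>r\<in>S. ?c1 r * P r)"
        using zero by simp_all
      then have "?c0 = ?c1"
        by (intro trans[OF the1_equality[OF ex[OF zero(1)], symmetric] the1_equality[OF ex[OF zero(1)]]]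
            conjI) auto
      then have "?c0 s = ?c1 s" "?c0 t = ?c1 t" by (simp_all only:)
      then show False using s t ab by simp
    qed
    then show "k = 1" using S by simp
  qed
qed

context cycle_chain begin

section \<open>2-cells and the first Betti number\<close>

lemma nx_mod: "nx (a mod n) = Suc a mod n"
  using n5 by (simp add: nx_def mod_Suc)

lemma nth_rotated: "k < n \<Longrightarrow> rotate j [0..<n] ! k = (j + k) mod n"
  by (simp add: nth_rotate add.commute)

lemma sum_rotated: "(\<Sum>k<n. f ((j + k) mod n)) = (\<Sum>i\<in>V. f i)"
proof -
  have "(\<Sum>i\<in>V. f i) = sum_list (map f (rotate j [0..<n]))"
    by (subst sum_list_distinct_conv_sum_set) auto
  also have "\<dots> = (\<Sum>k<n. f ((j + k) mod n))"
    by (simp add: sum_list_sum_nth nth_rotated atLeast0LessThan)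
  finally show ?thesis by simp
qed

lemma rotated_graph_cycle: "graph_cycle V p (rotate j [0..<n])"
proof -
  let ?xs = "rotate j [0..<n]"
  have adj: "adj V p (a mod n) (Suc a mod n)" for a
    using n5 by (simp add: adj_iff nx_mod)
  have "walk V p ?xs"
    unfolding walk_def using adj[of "j + _"] n5 by (auto simp: nth_rotated)
  moreover have "last ?xs = (j + (n - 1)) mod n" "hd ?xs = j mod n"
    using n5 by (simp_all add: last_conv_nth hd_conv_nth nth_rotated)
  moreover have "Suc (j + (n - 1)) mod n = j mod n" using n5 by simp
  ultimately show ?thesis
    using adj[of "j + (n - 1)"] n5 by (simp add: graph_cycle_def)
qed

text \<open>Label the whole cycle from \<open>pv i\<close> on: its first three edges are the long
  window. The remaining edges form the shorter arc, hence a geodesic, and the window is strictly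
  longer than the distance of its ends.\<close>

lemma rotated_cell:
  assumes d: "general_path_distance V p d" and i: "i < n"
  defines "w \<equiv> \<lambda>i. d i (nx i)"
  assumes window: "\<not> 2 * (w (pv i) + w i + w (nx i)) \<le> total w"
  shows "rotate (pv i) [0..<n] \<in> \<Union> (two_cells V p d)"
proof -
  define xs where "xs = rotate (pv i) [0..<n]"
  define ys where "ys = drop 3 xs @ [xs ! 0]"
  have len: "length xs = n" "length ys = n - 2" using n5 by (simp_all add: xs_def ys_def)
  have nth: "xs ! k = (pv i + k) mod n" if "k < n" for k
    using nth_rotated[OF that] by (simp add: xs_def)
  have x0: "xs ! 0 = pv i" using nth[of 0] i n5 by simp
  have x1: "xs ! 1 = i" using nth[of 1] nx_mod[of "pv i"] i n5 by simp
  have x2: "xs ! 2 = nx i" using nth[of 2] nx_mod[of "Suc (pv i)"] nx_mod[of "pv i"] i n5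
    by (simp add: numeral_2_eq_2)
  have x3: "xs ! 3 = nx (nx i)"
    using nth[of 3] nx_mod[of "Suc (Suc (pv i))"] nx_mod[of "Suc (pv i)"] nx_mod[of "pv i"] i n5
    by (simp add: numeral_3_eq_3)
  have ys_nth: "ys ! k = (pv i + 3 + k) mod n" if "k < n - 2" for k
  proof (cases "k < n - 3")
    case True
    then show ?thesis using nth[of "3 + k"] len by (simp add: ys_def nth_append add.assoc)
  next
    \<comment> \<open>The last entry is the appended start vertex, which is where the index closes
      up modulo \<open>n\<close>.\<close>
    case False
    then have "k = n - 3" using that by simp
    then have "ys ! k = pv i" and eq: "pv i + 3 + k = pv i + n"
      using len n5 x0 by (simp_all add: ys_def nth_append)
    then show ?thesis unfolding eq using i by simp
  qed
  have hd_last: "hd ys = nx (nx i)" "last ys = pv i"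
    using x3 x0 len n5 by (simp_all add: ys_def hd_append hd_drop_conv_nth)
  note c = general_path_distance_eq_circle[OF d, folded w_def]
  have wpos: "w k \<ge> 0" if "k < n" for k
    using general_path_distance_eq_circle(1)[OF d that] by (simp add: w_def)
  have win: "d (pv i) (nx (nx i)) = min (w (pv i) + w i + w (nx i)) (total w - (w (pv i) + w i + w (nx i)))"
    using circle_window(3)[of w i] c(3)[of "pv i" "nx (nx i)"] wpos i by simp
  have "walk_length d ys = (\<Sum>k<n - 3. w ((pv i + (3 + k)) mod n))"
    unfolding walk_length_def len(2) using n5 nx_mod
    by (intro sum.cong) (auto simp: ys_nth w_def add.assoc)
  also have "\<dots> = total w - (w (pv i) + w i + w (nx i))"
  proof -
    have "total w = (\<Sum>k<Suc (Suc (Suc (n - 3))). w ((pv i + k) mod n))"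
      using sum_rotated[of w "pv i"] n5 by (simp add: Suc_diff_Suc numeral_3_eq_3)
    also have "\<dots> = w (xs ! 0) + w (xs ! 1) + w (xs ! 2) + (\<Sum>k<n - 3. w ((pv i + (3 + k)) mod n))"
      using nth[of 0] nth[of 1] nth[of 2] n5
      by (simp add: sum.lessThan_Suc_shift numeral_3_eq_3 numeral_2_eq_2 del: sum.lessThan_Suc)
    finally have "total w = w (pv i) + w i + w (nx i) + (\<Sum>k<n - 3. w ((pv i + (3 + k)) mod n))"
      unfolding x0 x1 x2 .
    then show ?thesis by simp
  qed
  also have "\<dots> = d (nx (nx i)) (pv i)"
    using win window c(3)[of "pv i" "nx (nx i)"] c(3)[of "nx (nx i)" "pv i"] i
    by (simp add: circle_def abs_minus_commute min_def split: if_splits)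
  finally have wl: "walk_length d ys = d (hd ys) (last ys)" using hd_last by simp
  have "walk V p ys"
    unfolding walk_def
  proof (intro conjI allI impI)
    show "ys \<noteq> []" by (simp add: ys_def)
    show "set ys \<subseteq> V"
      using ys_nth len(2) n5 by (auto simp: in_set_conv_nth)
    fix k assume "Suc k < length ys"
    then show "adj V p (ys ! k) (ys ! Suc k)"
      using len(2) n5 nx_mod by (simp add: ys_nth adj_iff)
  qed
  then have "geodesic V p d (drop 3 xs @ [xs ! 0])" using wl by (simp add: geodesic_def ys_def)
  moreover have "d (xs ! 0) (xs ! 3) < d (xs ! 0) (xs ! 1) + d (xs ! 1) (xs ! 2) + d (xs ! 2) (xs ! 3)"
    unfolding x0 x1 x2 x3 win using window i by (simp add: w_def)
  ultimately have "cell_labeling V p d xs"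
    unfolding cell_labeling_def len(1) using n5 by simp
  then have "cycle_class xs \<in> two_cells V p d"
    using rotated_graph_cycle[of "pv i"] by (auto simp: two_cells_def xs_def)
  moreover have "xs \<in> cycle_class xs"
    unfolding cycle_class_def by (intro CollectI exI[of _ 0]) simp
  ultimately show ?thesis by (auto simp: xs_def)
qed

lemma walk_straight:
  assumes "adj V p x y" "adj V p y z" "x \<noteq> z"
  shows "(y = nx x \<and> z = nx y) \<or> (x = nx y \<and> y = nx z)"
  using assms by (auto simp: adj_iff)

text \<open>For the converse, distinctness forces a labeled cycle to run in one direction, so its
  first four vertices span a window. A window of at most half the cycle is a shortest path, against
  the strict inequality of a cell.\<close>

lemma two_cells_empty_iff:
  assumes d: "general_path_distance V p d"
  defines "w \<equiv> \<lambda>i. d i (nx i)"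
  shows "two_cells V p d = {} \<longleftrightarrow> (\<forall>i<n. 2 * (w (pv i) + w i + w (nx i)) \<le> total w)"
proof
  assume "two_cells V p d = {}"
  then show "\<forall>i<n. 2 * (w (pv i) + w i + w (nx i)) \<le> total w"
    using rotated_cell[OF d] unfolding w_def by blast
next
  assume win: "\<forall>i<n. 2 * (w (pv i) + w i + w (nx i)) \<le> total w"
  note c = general_path_distance_eq_circle[OF d, folded w_def]
  have sym: "d x y = d y x" if "x < n" "y < n" for x y
    using c(3)[of x y] c(3)[of y x] that by (simp add: circle_def abs_minus_commute)
  have wpos: "w k \<ge> 0" if "k < n" for k
    using general_path_distance_eq_circle(1)[OF d that] by (simp add: w_def)
  have far: "d a (nx (nx (nx a))) = w a + w (nx a) + w (nx (nx a))" if "a < n" for a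
    using circle_window(3)[of w "nx a"] c(3)[of a "nx (nx (nx a))"] wpos that win[rule_format, of "nx a"]
    by simp
  show "two_cells V p d = {}"
  proof (rule ccontr)
    assume "two_cells V p d \<noteq> {}"
    then obtain xs where cyc: "graph_cycle V p xs" and cell: "cell_labeling V p d xs"
      by (auto simp: two_cells_def)
    have len: "length xs \<ge> 3" and dist: "distinct xs" and walk: "walk V p xs"
      and last: "adj V p (last xs) (hd xs)" using cyc by (auto simp: graph_cycle_def)
    have adj: "adj V p (xs ! k) (xs ! Suc k)" if "Suc k < length xs" for k
      using walk that by (simp add: walk_def)
    have neq: "xs ! j \<noteq> xs ! k" if "j \<noteq> k" "j < length xs" "k < length xs" for j k
      using dist that by (simp add: nth_eq_iff_index_eq)
    have V: "xs ! k < n" if "k < length xs" for k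
      using walk that by (auto simp: walk_def dest: nth_mem)
    have "xs \<noteq> []" using len by auto
    define a where "a = xs ! 0"
    define b where "b = xs ! 1"
    define e where "e = xs ! 2"
    have abe: "a < n" "b < n" "e < n" "adj V p a b" "adj V p b e" "a \<noteq> b" "b \<noteq> e" "a \<noteq> e"
      using \<open>xs \<noteq> []\<close> V[of 0] V[of 1] V[of 2] adj[of 0] adj[of 1] neq[of 0 1] neq[of 1 2] neq[of 0 2] len
      unfolding a_def b_def e_def by (simp_all add: numeral_2_eq_2)
    have st: "(b = nx a \<and> e = nx b) \<or> (a = nx b \<and> b = nx e)" by (rule walk_straight) (use abe in auto)
    show False
    proof (cases "length xs = 3")
      \<comment> \<open>A triangle would make \<open>a\<close> and \<open>e\<close> adjacent
        although they are two steps apart.\<close>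
      case True
      then have "last xs = e" "hd xs = a"
        using last_conv_nth[of xs] hd_conv_nth[of xs] \<open>xs \<noteq> []\<close> by (auto simp: a_def e_def)
      then have "a = nx e \<or> a = pv e" using last by (auto simp: adj_iff)
      then show False
        using st abe nx_pv_distinct(8)[of a] nx_pv_distinct(8)[of e] nx_pv_distinct(6)[of e] by auto
    next
      case False
      then have len4: "length xs \<ge> 4" using len by simp
      define g where "g = xs ! 3"
      have g: "g < n" "adj V p e g" "b \<noteq> g"
        using V[of 3] adj[of 2] neq[of 1 3] len4 unfolding b_def e_def g_def
        by (simp_all add: numeral_3_eq_3 numeral_2_eq_2)
      have "(e = nx b \<and> g = nx e) \<or> (b = nx e \<and> e = nx g)" by (rule walk_straight) (use abe g in auto)
      \<comment> \<open>A change of direction at \<open>b\<close> would give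
        \<open>a = e\<close>.\<close>
      moreover have "\<not> (b = nx a \<and> b = nx e)"
      proof
        assume "b = nx a \<and> b = nx e"
        then have "nx a = nx e" by metis
        then have "pv (nx a) = pv (nx e)" by (rule arg_cong)
        then show False using abe by simp
      qed
      moreover have "\<not> (a = nx b \<and> e = nx b)" using abe by auto
      ultimately have "(b = nx a \<and> e = nx b \<and> g = nx e) \<or> (a = nx b \<and> b = nx e \<and> e = nx g)"
        using st by blast
      then have "d a g = d a b + d b e + d e g"
      proof
        assume "b = nx a \<and> e = nx b \<and> g = nx e"
        then show ?thesis using far[of a] abe by (simp add: w_def)
      next
        assume *: "a = nx b \<and> b = nx e \<and> e = nx g"
        have "d g a = d e b + d b a + d g e"
          using far[of g] g * by (simp add: w_def)
        then show ?thesis using sym[of g a] sym[of e b] sym[of b a] sym[of g e] abe g by linarith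
      qed
      moreover have "d a g < d a b + d b e + d e g"
        using cell len4 by (auto simp: cell_labeling_def a_def b_def e_def g_def)
      ultimately show False by simp
    qed
  qed
qed

section \<open>Periods of 1-forms and the Betti number\<close>

definition period :: "(nat \<times> nat \<Rightarrow> real) \<Rightarrow> real" where
  "period \<alpha> = (\<Sum>i\<in>V. \<alpha> (i, nx i))"

text \<open>Partial sums of \<open>\<alpha>\<close> along the cycle give a primitive, negated
  because \<open>coboundary0\<close> is tail minus head. Its condition on the edge from
  \<open>n - 1\<close> to 0 is met because the period vanishes.\<close>

lemma exact_forms_eq: "exact_forms V p = {\<alpha> \<in> one_forms V p. period \<alpha> = 0}"
proof (intro equalityI subsetI)
  fix \<alpha> assume "\<alpha> \<in> exact_forms V p"
  then obtain f where f: "\<alpha> = coboundary0 V p f" by (auto simp: exact_forms_def)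
  have "period \<alpha> = (\<Sum>i\<in>V. f i - f (nx i))"
    unfolding period_def by (rule sum.cong) (auto simp: f coboundary0_def adj_iff)
  also have "\<dots> = 0" using sum_nx[of f] by (simp add: sum_subtractf)
  finally show "\<alpha> \<in> {\<alpha> \<in> one_forms V p. period \<alpha> = 0}"
    using adj_sym by (auto simp: f one_forms_def coboundary0_def)
next
  fix \<alpha> assume \<alpha>: "\<alpha> \<in> {\<alpha> \<in> one_forms V p. period \<alpha> = 0}"
  define f where "f i = - pos (\<lambda>i. \<alpha> (i, nx i)) i" for i
  have f: "f i - f (nx i) = \<alpha> (i, nx i)" if "i < n" for i
    using \<alpha> pos_nx[OF that, of "\<lambda>i. \<alpha> (i, nx i)"] by (simp add: f_def period_def)
  have "\<alpha> (x, y) = coboundary0 V p f (x, y)" for x y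
  proof (cases "adj V p x y")
    case True
    then have x: "x < n" "y = nx x \<or> y = pv x" by (auto simp: adj_iff)
    show ?thesis
    proof (cases "y = nx x")
      case False
      then have y: "y = pv x" "y < n" "nx y = x" using x by auto
      have "\<alpha> (x, y) = - \<alpha> (y, x)" using \<alpha> True by (auto simp: one_forms_def)
      then show ?thesis using f[OF y(2)] y True by (simp add: coboundary0_def)
    qed (use f[OF x(1)] True in \<open>simp add: coboundary0_def\<close>)
  next
    case False
    then show ?thesis using \<alpha> by (simp add: one_forms_def coboundary0_def)
  qed
  then have "\<alpha> = coboundary0 V p f" by (auto simp: fun_eq_iff)
  then show "\<alpha> \<in> exact_forms V p" by (simp add: exact_forms_def)
qed

lemma coboundary1_rotated: "coboundary1 \<alpha> (rotate j [0..<n]) = period \<alpha>"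
proof -
  have "coboundary1 \<alpha> (rotate j [0..<n]) = (\<Sum>k<n. \<alpha> ((j + k) mod n, nx ((j + k) mod n)))"
    unfolding coboundary1_def
  proof (rule sum.cong)
    fix k assume "k \<in> {..<n}"
    then have "k < n" by simp
    have "(j + Suc k mod n) mod n = nx ((j + k) mod n)"
      by (simp add: nx_mod mod_add_right_eq)
    then show "\<alpha> (rotate j [0..<n] ! k, rotate j [0..<n] ! (Suc k mod length (rotate j [0..<n]))) =
        \<alpha> ((j + k) mod n, nx ((j + k) mod n))"
      using \<open>k < n\<close> n5 by (simp add: nth_rotated)
  qed simp
  then show ?thesis unfolding period_def by (simp add: sum_rotated[of "\<lambda>i. \<alpha> (i, nx i)"])
qed

text \<open>Without cells every 1-form is closed and the period identifies the quotient with the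
  reals. A cell containing a rotation of the whole cycle forces the period of closed forms to
  vanish, so they are exact.\<close>

lemma betti1_eq:
  assumes d: "general_path_distance V p d"
  shows "betti1 V p d = (if two_cells V p d = {} then 1 else 0)"
proof (cases "two_cells V p d = {}")
  case True
  then have closed: "closed_forms V p d = one_forms V p" by (simp add: closed_forms_def)
  \<comment> \<open>The unit form along the orientation of the cycle, of period
    \<open>n\<close>.\<close>
  define \<eta> :: "nat \<times> nat \<Rightarrow> real" where
    "\<eta> = (\<lambda>(x, y). if x < n \<and> y = nx x then 1 else if x < n \<and> y = pv x then -1 else 0)"
  have "quotient_dim (one_forms V p) (exact_forms V p) = 1"
  proof (rule quotient_dim_eq_1[where P = period and \<eta> = \<eta>, OF exact_forms_eq])
    show "(\<lambda>_. 0) \<in> one_forms V p" by (simp add: one_forms_def)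
    show "period (\<lambda>_. 0) = 0" by (simp add: period_def)
    have D: "nx (nx x) \<noteq> x" "pv (pv x) \<noteq> x" "pv x \<noteq> nx x" if "x < n" for x
      using that n5 by (auto simp: nx_def pv_def split: if_splits)
    show "\<eta> \<in> one_forms V p"
      using D by (auto simp: one_forms_def \<eta>_def adj_iff)
    have "period \<eta> = (\<Sum>i\<in>V. 1)" unfolding period_def by (rule sum.cong) (auto simp: \<eta>_def)
    then show "period \<eta> \<noteq> 0" using n5 by simp
  next
    fix \<alpha> c and S :: "(nat \<times> nat \<Rightarrow> real) set"
    assume \<alpha>: "\<alpha> \<in> one_forms V p" and S: "S \<subseteq> one_forms V p" "finite S"
    have "(\<Sum>s\<in>S. c s * s (x, y)) = - (\<Sum>s\<in>S. c s * s (y, x))" if "adj V p x y" for x y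
      unfolding sum_negf[symmetric] using S that by (intro sum.cong) (auto simp: one_forms_def)
    moreover have "(\<Sum>s\<in>S. c s * s (x, y)) = 0" if "\<not> adj V p x y" for x y
      using S that by (intro sum.neutral) (auto simp: one_forms_def)
    ultimately have "(\<lambda>e. \<alpha> e - (\<Sum>s\<in>S. c s * s e)) \<in> one_forms V p"
      using \<alpha> by (simp add: one_forms_def)
    moreover have "period (\<lambda>e. \<alpha> e - (\<Sum>s\<in>S. c s * s e)) = period \<alpha> - (\<Sum>s\<in>S. c s * period s)"
      unfolding period_def by (simp add: sum_subtractf sum_distrib_left sum.swap[of _ S])
    ultimately show "(\<lambda>e. \<alpha> e - (\<Sum>s\<in>S. c s * s e)) \<in> one_forms V p \<and>
        period (\<lambda>e. \<alpha> e - (\<Sum>s\<in>S. c s * s e)) = period \<alpha> - (\<Sum>s\<in>S. c s * period s)" ..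
  qed
  then show ?thesis using True closed by (simp add: betti1_def)
next
  case False
  \<comment> \<open>Passing through a long window produces a cell with a representative in
    increasing cyclic order, on which \<open>coboundary1\<close> is the period.\<close>
  then obtain i where "i < n"
    and "\<not> 2 * (d (pv i) (nx (pv i)) + d i (nx i) + d (nx i) (nx (nx i))) \<le> total (\<lambda>i. d i (nx i))"
    using two_cells_empty_iff[OF d] by blast
  then have cell: "rotate (pv i) [0..<n] \<in> \<Union> (two_cells V p d)" by (rule rotated_cell[OF d])
  have "quotient_dim (closed_forms V p d) (exact_forms V p) = 0"
  proof (rule quotient_dim_eq_0)
    show "closed_forms V p d \<subseteq> exact_forms V p"
    proof
      fix \<alpha> assume \<alpha>: "\<alpha> \<in> closed_forms V p d"
      then have "coboundary1 \<alpha> (rotate (pv i) [0..<n]) = 0"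
        using cell by (auto simp: closed_forms_def)
      then show "\<alpha> \<in> exact_forms V p"
        using \<alpha> by (simp add: coboundary1_rotated exact_forms_eq closed_forms_def)
    qed
    show "(\<lambda>_. 0) \<in> closed_forms V p d"
      by (simp add: closed_forms_def one_forms_def coboundary1_def)
  next
    fix \<alpha> assume "\<alpha> \<in> exact_forms V p"
    then show "(\<lambda>e. - \<alpha> e) \<in> exact_forms V p"
      by (simp add: exact_forms_eq one_forms_def period_def sum_negf)
  qed
  then show ?thesis using False by (simp add: betti1_def)
qed

lemma max_degree_eq: "max_degree V p = 2"
proof -
  have "card {y. adj V p x y} = 2" if "x < n" for x
  proof -
    have "{y. adj V p x y} = {nx x, pv x}" using that by (auto simp: adj_iff)
    then show ?thesis using nx_pv_distinct(3)[OF that] by simp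
  qed
  then have "(\<lambda>x. card {y. adj V p x y}) ` V = (\<lambda>_. 2) ` V" by (intro image_cong) auto
  also have "\<dots> = {2}" using n5 by (simp add: image_constant_conv)
  finally have "(\<lambda>x. card {y. adj V p x y}) ` V = {2}" .
  then show ?thesis by (simp add: max_degree_def)
qed

text \<open>Both sides say that no three consecutive edges exceed half the cycle.\<close>

lemma zero_curvature_iff_no_cells:
  assumes d: "general_path_distance V p d" and "constant_curvature V p d"
  shows "(\<forall>x y. adj V p x y \<longrightarrow> ollivier_curvature V p d x y = 0) \<longleftrightarrow> two_cells V p d = {}"
    and "\<forall>x y. adj V p x y \<longrightarrow> ollivier_curvature V p d x y \<ge> 0"
proof -
  obtain K where K: "\<And>i. i < n \<Longrightarrow> ollivier_curvature V p d i (nx i) = K"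
    using assms(2) constant_curvature_iff[OF d] by blast
  note sign = constant_curvature_sign[OF d K]
  have "(\<forall>i<n. ollivier_curvature V p d i (nx i) = 0) \<longleftrightarrow> K = 0" using K n5 by force
  then show "(\<forall>x y. adj V p x y \<longrightarrow> ollivier_curvature V p d x y = 0) \<longleftrightarrow> two_cells V p d = {}"
    unfolding curvature_all_edges[OF d, of "\<lambda>k. k = 0"] using sign(2) two_cells_empty_iff[OF d] by blast
  show "\<forall>x y. adj V p x y \<longrightarrow> ollivier_curvature V p d x y \<ge> 0"
    unfolding curvature_all_edges[OF d, of "\<lambda>k. k \<ge> 0"] using sign(1) K by simp
qed

text \<open>Curvature is nonnegative anyway and half the maximal degree is 1, so sharpness says that
  the Betti number is 1.\<close>

lemma sharp_iff_no_cells: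
  assumes "general_path_distance V p d" "constant_curvature V p d"
  shows "ollivier_betti_sharp V p d \<longleftrightarrow> two_cells V p d = {}"
  using zero_curvature_iff_no_cells(2)[OF assms] betti1_eq[OF assms(1)] max_degree_eq
  by (simp add: ollivier_betti_sharp_def)

end

theorem theorem6p4:
  fixes n :: nat and V :: "nat set" and p :: "nat \<Rightarrow> nat \<Rightarrow> real"
  assumes "n \<ge> 5"
    and "V = {0..<n}"
    and "markov_kernel V p"
    and "\<forall>i\<in>V. \<forall>j\<in>V. p i j > 0 \<longleftrightarrow> j \<in> {(i + 1) mod n, (i + n - 1) mod n}"
  shows "(\<exists>d. general_path_distance V p d \<and> constant_curvature V p d) \<and>
    (\<forall>d d'. general_path_distance V p d \<and> constant_curvature V p d \<and>
            general_path_distance V p d' \<and> constant_curvature V p d' \<longrightarrow>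
            (\<exists>c>0. \<forall>x\<in>V. \<forall>y\<in>V. d' x y = c * d x y)) \<and>
    (\<forall>d. general_path_distance V p d \<and> constant_curvature V p d \<longrightarrow>
         (ollivier_betti_sharp V p d \<longleftrightarrow>
            (\<forall>x y. adj V p x y \<longrightarrow> ollivier_curvature V p d x y = 0)) \<and>
         ((\<forall>x y. adj V p x y \<longrightarrow> ollivier_curvature V p d x y = 0) \<longleftrightarrow>
            two_cells V p d = {}))"
proof -
  interpret cycle_chain n p
    using assms(1,3,4) unfolding assms(2) by unfold_locales
  show ?thesis
    unfolding assms(2)
  proof (intro conjI allI impI; (elim conjE)?)
    show "\<exists>d. general_path_distance {0..<n} p d \<and> constant_curvature {0..<n} p d"
      by (rule constant_curvature_exists)
  qed (simp_all only: constant_curvature_unique zero_curvature_iff_no_cells(1) sharp_iff_no_cells)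
qed

end
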